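(* Let $K$ be a field and $\lambda\in K$. Let $(A,\mu,\Delta,\alpha_A,\beta_A,\psi_A,\omega_A)$ be a $\lambda$-infBH-bialgebra, let $(M,\mu_M,\triangleright,\triangleleft,\alpha_M,\beta_M)$ be a BiHom-bimodule algebra over $(A,\mu,\alpha_A,\beta_A)$ and, at the same time, let $(M,\Delta_M,\rho,\varphi,\psi_M,\omega_M)$ be a BiHom-bicomodule coalgebra over $(A,\Delta,\psi_A,\omega_A)$. On $A\oplus M$ define, for $a,b\in A$, $m,n\in M$, $$(a+m)(b+n)=ab+a\triangleright n+m\triangleleft b+mn,$$ $$\Delta_{A\oplus M}(a+m)=a_1\otimes a_2+m_{(-1)}\otimes m_{(0)}+m_{(0)}\otimes m_{(1)}+m_1\otimes m_2,$$ where $\Delta(a)=a_1\otimes a_2$, $\rho(m)=m_{(-1)}\otimes m_{(0)}\in A\otimes M$, $\varphi(m)=m_{(0)}\otimes m_{(1)}\in M\otimes A$, $\Delta_M(m)=m_1\otimes m_2$. Then $A\oplus M$ with this multiplication $\mu_{A\oplus M}$, this comultiplication and the maps $\alpha_A\oplus\alpha_M,\ \beta_A\oplus\beta_M,\ \psi_A\oplus\psi_M,\ \omega_A\oplus\omega_M$ is a $\lambda$-infBH-bialgebra if and only if the following four conditions hold: (a) $(M,\triangleright,\triangleleft,\rho,\varphi,\alpha_M,\beta_M,\psi_M,\omega_M)$ is a $\lambda$-infBH-Hopf bimodule over $(A,\mu,\Delta,\alpha_A,\beta_A,\psi_A,\omega_A)$; (b) $(M,\Delta_M,\triangleright,\triangleleft,\alpha_M,\beta_M,\psi_M,\omega_M)$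 is a BiHom-bimodule coalgebra; (c) $(M,\mu_M,\rho,\varphi,\alpha_M,\beta_M,\psi_M,\omega_M)$ is a BiHom-bicomodule algebra; (d) for all $m,n\in M$, $$\Delta_M(mn)=\omega_M(m)n_1\otimes\beta_M(n_2)+\alpha_M(m_1)\otimes m_2\psi_M(n)+\lambda\,\alpha_M\omega_M(m)\otimes\beta_M\psi_M(n)$$ $$\qquad+\,\omega_M(m)\triangleleft n_{(-1)}\otimes\beta_M(n_{(0)})+\alpha_M(m_{(0)})\otimes m_{(1)}\triangleright\psi_M(n).$$
   Context: All spaces, maps and tensor products are over $K$. (Co)units are not assumed. $(f\oplus g)(a+m)=f(a)+g(m)$. BiHom-associative algebra $(A,\mu,\alpha,\beta)$: linear $\mu:A\otimes A\to A$ (written $ab$), $\alpha,\beta:A\to A$ with $\alpha\beta=\beta\alpha$, $\alpha(ab)=\alpha(a)\alpha(b)$, $\beta(ab)=\beta(a)\beta(b)$, $\alpha(a)(bc)=(ab)\beta(c)$. BiHom-coassociative coalgebra $(C,\Delta,\psi,\omega)$: $\psi\omega=\omega\psi$, $(\psi\otimes\psi)\Delta=\Delta\psi$, $(\omega\otimes\omega)\Delta=\Delta\omega$, $(\Delta\otimes\psi)\Delta=(\omega\otimes\Delta)\Delta$. $\lambda$-infBH-bialgebra $(A,\mu,\Delta,\alpha,\beta,\psi,\omega)$: $(A,\mu,\alpha,\beta)$ is BiHom-associative, $(A,\Delta,\psi,\omega)$ is BiHom-coassociative, each of $\alpha,\beta$ commutes with each of $\psi,\omega$, $(\alpha\otimes\alpha)\Delta=\Delta\alpha$,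 $(\beta\otimes\beta)\Delta=\Delta\beta$, $\psi$ and $\omega$ are multiplicative, and $\Delta(ab)=\omega(a)b_1\otimes\beta(b_2)+\alpha(a_1)\otimes a_2\psi(b)+\lambda\,\alpha\omega(a)\otimes\beta\psi(b)$. Left module $(M,\triangleright,\alpha_M,\beta_M)$ over $(A,\mu,\alpha_A,\beta_A)$: $\alpha_M\beta_M=\beta_M\alpha_M$, $\alpha_M(a\triangleright m)=\alpha_A(a)\triangleright\alpha_M(m)$, $\beta_M(a\triangleright m)=\beta_A(a)\triangleright\beta_M(m)$, $\alpha_A(a)\triangleright(a'\triangleright m)=(aa')\triangleright\beta_M(m)$. Right module: analogously, with $\alpha_M(m)\triangleleft(aa')=(m\triangleleft a)\triangleleft\beta_A(a')$. Bimodule: both, and $\alpha_A(a)\triangleright(m\triangleleft a')=(a\triangleright m)\triangleleft\beta_A(a')$. BiHom-bimodule algebra: a bimodule with $(M,\mu_M,\alpha_M,\beta_M)$ BiHom-associative and $\alpha_A(a)\triangleright(mn)=(a\triangleright m)\beta_M(n)$, $\alpha_M(m)(n\triangleleft a)=(mn)\triangleleft\beta_A(a)$, $\alpha_M(m)(a\triangleright n)=(m\triangleleft a)\beta_M(n)$. Left comodule $(M,\rho,\psi_M,\omega_M)$ over $(A,\Delta,\psi_A,\omega_A)$: $\psi_M\omega_M=\omega_M\psi_M$, $(\psi_A\otimes\psi_M)\rho=\rho\psi_M$, $(\omega_A\otimes\omega_M)\rho=\rho\omega_M$, $(\omega_A\otimes\rho)\rho=(\Delta\otimes\psi_M)\rho$.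 Right comodule $(M,\varphi,\psi_M,\omega_M)$: analogously, with $(\omega_M\otimes\Delta)\varphi=(\varphi\otimes\psi_A)\varphi$. Bicomodule: both, and $(\omega_A\otimes\varphi)\rho=(\rho\otimes\psi_A)\varphi$. BiHom-bicomodule coalgebra: a bicomodule with $(M,\Delta_M,\psi_M,\omega_M)$ BiHom-coassociative and $(\omega_A\otimes\Delta_M)\rho=(\rho\otimes\psi_M)\Delta_M$, $(\omega_M\otimes\varphi)\Delta_M=(\Delta_M\otimes\psi_A)\varphi$, $(\omega_M\otimes\rho)\Delta_M=(\varphi\otimes\psi_M)\Delta_M$. $\lambda$-infBH-Hopf bimodule: any two of $\alpha_M,\beta_M,\psi_M,\omega_M$ commute; $(M,\triangleright,\triangleleft,\alpha_M,\beta_M)$ is a bimodule; $(M,\rho,\varphi,\psi_M,\omega_M)$ is a bicomodule; and $\rho(a\triangleright m)=\omega_A(a)m_{(-1)}\otimes\beta_M(m_{(0)})+\alpha_A(a_1)\otimes a_2\triangleright\psi_M(m)+\lambda\,\alpha_A\omega_A(a)\otimes\beta_M\psi_M(m)$, $\varphi(m\triangleleft a)=\omega_M(m)\triangleleft a_1\otimes\beta_A(a_2)+\alpha_M(m_{(0)})\otimes m_{(1)}\psi_A(a)+\lambda\,\alpha_M\omega_M(m)\otimes\beta_A\psi_A(a)$, $\varphi(a\triangleright m)=\omega_A(a)\triangleright m_{(0)}\otimes\beta_A(m_{(1)})$, $\rho(m\triangleleft a)=\alpha_A(m_{(-1)})\otimes m_{(0)}\triangleleft\psi_A(a)$. BiHom-bimodule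 coalgebra: $(M,\triangleright,\triangleleft,\alpha_M,\beta_M)$ is a bimodule, $(M,\Delta_M,\psi_M,\omega_M)$ is BiHom-coassociative, any two of $\alpha_M,\beta_M,\psi_M,\omega_M$ commute, $\Delta_M\alpha_M=(\alpha_M\otimes\alpha_M)\Delta_M$, $\Delta_M\beta_M=(\beta_M\otimes\beta_M)\Delta_M$; for $f\in\{\psi,\omega\}$, $f_M(a\triangleright m)=f_A(a)\triangleright f_M(m)$ and $f_M(m\triangleleft a)=f_M(m)\triangleleft f_A(a)$; and $\Delta_M(a\triangleright m)=\omega_A(a)\triangleright m_1\otimes\beta_M(m_2)$, $\Delta_M(m\triangleleft a)=\alpha_M(m_1)\otimes m_2\triangleleft\psi_A(a)$. BiHom-bicomodule algebra: $(M,\rho,\varphi,\psi_M,\omega_M)$ is a bicomodule, $(M,\mu_M,\alpha_M,\beta_M)$ is BiHom-associative, any two of $\alpha_M,\beta_M,\psi_M,\omega_M$ commute, $\psi_M,\omega_M$ are multiplicative for $\mu_M$; for $f\in\{\alpha,\beta\}$, $(f_A\otimes f_M)\rho=\rho f_M$ and $(f_M\otimes f_A)\varphi=\varphi f_M$; and $\rho(mn)=\alpha_A(m_{(-1)})\otimes m_{(0)}\psi_M(n)$, $\varphi(mn)=\omega_M(m)n_{(0)}\otimes\beta_A(n_{(1)})$. *)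

theory Defs
  imports "HOL-Analysis.Product_Vector" "HOL-Library.Function_Algebras"
begin

text \<open>
  A vector space over the field \<open>'k\<close> is a type \<open>'a :: ab_group_add\<close> together with a scalar
  multiplication \<open>s\<close> satisfying \<open>vector_space s\<close>.
\<close>

definition bilinear_map ::
  "('k::field \<Rightarrow> 'a::ab_group_add \<Rightarrow> 'a) \<Rightarrow> ('k \<Rightarrow> 'b::ab_group_add \<Rightarrow> 'b) \<Rightarrow>
   ('k \<Rightarrow> 'c::ab_group_add \<Rightarrow> 'c) \<Rightarrow> ('a \<Rightarrow> 'b \<Rightarrow> 'c) \<Rightarrow> bool" where
  "bilinear_map s1 s2 s f \<longleftrightarrow>
     (\<forall>x. Vector_Spaces.linear s2 s (f x)) \<and>
     (\<forall>y. Vector_Spaces.linear s1 s (\<lambda>x. f x y))"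

definition trilinear_map ::
  "('k::field \<Rightarrow> 'a::ab_group_add \<Rightarrow> 'a) \<Rightarrow> ('k \<Rightarrow> 'b::ab_group_add \<Rightarrow> 'b) \<Rightarrow>
   ('k \<Rightarrow> 'c::ab_group_add \<Rightarrow> 'c) \<Rightarrow> ('k \<Rightarrow> 'd::ab_group_add \<Rightarrow> 'd) \<Rightarrow>
   ('a \<Rightarrow> 'b \<Rightarrow> 'c \<Rightarrow> 'd) \<Rightarrow> bool" where
  "trilinear_map s1 s2 s3 s f \<longleftrightarrow>
     (\<forall>x. bilinear_map s2 s3 s (f x)) \<and>
     (\<forall>z. bilinear_map s1 s2 s (\<lambda>x y. f x y z))"


section \<open>Tensor products\<close>

text \<open>
  The tensor product of two vector spaces is realised as the span, inside the functionals on
  bilinear forms, of the evaluations \<open>x \<otimes> y = (F \<mapsto> F x y)\<close>. Functionals are total functions on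
  all \<open>F\<close>, so they are normalised to \<open>0\<close> on those \<open>F\<close> that are not bilinear.
  That this is the tensor product is the universal property \<open>tensor_universal\<close> below.
  Threefold tensor products are treated in the same way with trilinear forms
  (\<open>tensor3_universal\<close>); the identifications of \<open>(A \<otimes> B) \<otimes> C\<close> and \<open>A \<otimes> (B \<otimes> C)\<close>
  with \<open>A \<otimes> B \<otimes> C\<close> are built into the maps \<open>tensor_map_left\<close> and \<open>tensor_map_right\<close>.
\<close>

type_synonym ('a, 'b, 'k) tensor = "('a \<Rightarrow> 'b \<Rightarrow> 'k) \<Rightarrow> 'k"
type_synonym ('a, 'b, 'c, 'k) tensor3 = "('a \<Rightarrow> 'b \<Rightarrow> 'c \<Rightarrow> 'k) \<Rightarrow> 'k"

definition fscale :: "'k::field \<Rightarrow> ('x \<Rightarrow> 'k) \<Rightarrow> 'x \<Rightarrow> 'k" where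
  "fscale c t = (\<lambda>x. c * t x)"

definition tensor ::
  "('k::field \<Rightarrow> 'a::ab_group_add \<Rightarrow> 'a) \<Rightarrow> ('k \<Rightarrow> 'b::ab_group_add \<Rightarrow> 'b) \<Rightarrow>
   'a \<Rightarrow> 'b \<Rightarrow> ('a, 'b, 'k) tensor" where
  "tensor s1 s2 x y = (\<lambda>F. if bilinear_map s1 s2 (*) F then F x y else 0)"

definition tensor_space ::
  "('k::field \<Rightarrow> 'a::ab_group_add \<Rightarrow> 'a) \<Rightarrow> ('k \<Rightarrow> 'b::ab_group_add \<Rightarrow> 'b) \<Rightarrow>
   ('a, 'b, 'k) tensor set" where
  "tensor_space s1 s2 = module.span fscale (range (\<lambda>(x, y). tensor s1 s2 x y))"

definition tensor3 ::
  "('k::field \<Rightarrow> 'a::ab_group_add \<Rightarrow> 'a) \<Rightarrow> ('k \<Rightarrow> 'b::ab_group_add \<Rightarrow> 'b) \<Rightarrow>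
   ('k \<Rightarrow> 'c::ab_group_add \<Rightarrow> 'c) \<Rightarrow> 'a \<Rightarrow> 'b \<Rightarrow> 'c \<Rightarrow> ('a, 'b, 'c, 'k) tensor3" where
  "tensor3 s1 s2 s3 x y z = (\<lambda>F. if trilinear_map s1 s2 s3 (*) F then F x y z else 0)"

definition tensor3_space ::
  "('k::field \<Rightarrow> 'a::ab_group_add \<Rightarrow> 'a) \<Rightarrow> ('k \<Rightarrow> 'b::ab_group_add \<Rightarrow> 'b) \<Rightarrow>
   ('k \<Rightarrow> 'c::ab_group_add \<Rightarrow> 'c) \<Rightarrow> ('a, 'b, 'c, 'k) tensor3 set" where
  "tensor3_space s1 s2 s3 = module.span fscale (range (\<lambda>(x, y, z). tensor3 s1 s2 s3 x y z))"

definition linear_to_tensor ::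
  "('k::field \<Rightarrow> 'c::ab_group_add \<Rightarrow> 'c) \<Rightarrow> ('k \<Rightarrow> 'a::ab_group_add \<Rightarrow> 'a) \<Rightarrow>
   ('k \<Rightarrow> 'b::ab_group_add \<Rightarrow> 'b) \<Rightarrow> ('c \<Rightarrow> ('a, 'b, 'k) tensor) \<Rightarrow> bool" where
  "linear_to_tensor s s1 s2 D \<longleftrightarrow>
     Vector_Spaces.linear s fscale D \<and> range D \<subseteq> tensor_space s1 s2"

text \<open>
  \<open>tensor_map s1 s2 f g\<close> is \<open>f \<otimes> g\<close>, where \<open>s1\<close> and \<open>s2\<close> are the scalar multiplications of the
  codomains of \<open>f\<close> and \<open>g\<close>. In Sweedler notation \<open>f(c\<^sub>1) \<otimes> g(c\<^sub>2)\<close> is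
  \<open>tensor_map s1 s2 f g (\<Delta> c)\<close>.
\<close>

definition tensor_map ::
  "('k::field \<Rightarrow> 'c::ab_group_add \<Rightarrow> 'c) \<Rightarrow> ('k \<Rightarrow> 'd::ab_group_add \<Rightarrow> 'd) \<Rightarrow>
   ('a \<Rightarrow> 'c) \<Rightarrow> ('b \<Rightarrow> 'd) \<Rightarrow> ('a, 'b, 'k) tensor \<Rightarrow> ('c, 'd, 'k) tensor" where
  "tensor_map s1 s2 f g t =
     (\<lambda>F. if bilinear_map s1 s2 (*) F then t (\<lambda>x y. F (f x) (g y)) else 0)"

text \<open>
  \<open>D \<otimes> g\<close> and \<open>f \<otimes> D\<close> for a map \<open>D\<close> into a tensor product; the result lives in the tensor
  product of the three spaces with scalar multiplications \<open>s1\<close>, \<open>s2\<close>, \<open>s3\<close>.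
\<close>

definition tensor_map_left ::
  "('k::field \<Rightarrow> 'c::ab_group_add \<Rightarrow> 'c) \<Rightarrow> ('k \<Rightarrow> 'd::ab_group_add \<Rightarrow> 'd) \<Rightarrow>
   ('k \<Rightarrow> 'e::ab_group_add \<Rightarrow> 'e) \<Rightarrow> ('a \<Rightarrow> ('c, 'd, 'k) tensor) \<Rightarrow> ('b \<Rightarrow> 'e) \<Rightarrow>
   ('a, 'b, 'k) tensor \<Rightarrow> ('c, 'd, 'e, 'k) tensor3" where
  "tensor_map_left s1 s2 s3 D g t =
     (\<lambda>F. if trilinear_map s1 s2 s3 (*) F
          then t (\<lambda>x y. D x (\<lambda>u v. F u v (g y))) else 0)"

definition tensor_map_right ::
  "('k::field \<Rightarrow> 'c::ab_group_add \<Rightarrow> 'c) \<Rightarrow> ('k \<Rightarrow> 'd::ab_group_add \<Rightarrow> 'd) \<Rightarrow>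
   ('k \<Rightarrow> 'e::ab_group_add \<Rightarrow> 'e) \<Rightarrow> ('a \<Rightarrow> 'c) \<Rightarrow> ('b \<Rightarrow> ('d, 'e, 'k) tensor) \<Rightarrow>
   ('a, 'b, 'k) tensor \<Rightarrow> ('c, 'd, 'e, 'k) tensor3" where
  "tensor_map_right s1 s2 s3 f D t =
     (\<lambda>F. if trilinear_map s1 s2 s3 (*) F
          then t (\<lambda>x y. D y (\<lambda>u v. F (f x) u v)) else 0)"


subsection \<open>Adequacy of the construction\<close>

lemma linear_field_iff:
  "Vector_Spaces.linear s1 s2 f \<longleftrightarrow>
     vector_space s1 \<and> vector_space s2 \<and>
     (\<forall>x y. f (x + y) = f x + f y) \<and> (\<forall>c x. f (s1 c x) = s2 c (f x))"
  by (simp add: Vector_Spaces.linear_def module_hom_def module_hom_axioms_def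
      module_iff_vector_space) blast

lemma vector_space_mult: "vector_space ((*) :: 'k::field \<Rightarrow> 'k \<Rightarrow> 'k)"
  by unfold_locales (simp_all add: algebra_simps)

lemma vector_space_fscale: "vector_space (fscale :: 'k::field \<Rightarrow> ('x \<Rightarrow> 'k) \<Rightarrow> _)"
  by unfold_locales (auto simp: fscale_def algebra_simps fun_eq_iff)

lemma module_fscale: "module (fscale :: 'k::field \<Rightarrow> ('x \<Rightarrow> 'k) \<Rightarrow> _)"
  using vector_space_fscale by (simp add: module_iff_vector_space)

lemma linear_eval: "Vector_Spaces.linear fscale (*) (\<lambda>t. t F)"
  by (simp add: linear_field_iff vector_space_mult vector_space_fscale fscale_def)

lemma linear_functional_separates:
  fixes s :: "'k::field \<Rightarrow> 'v::ab_group_add \<Rightarrow> 'v"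
  assumes "vector_space s" and "v \<noteq> w"
  shows "\<exists>\<phi>. Vector_Spaces.linear s (*) \<phi> \<and> \<phi> v \<noteq> \<phi> w"
proof -
  interpret V: vector_space_pair s "(*) :: 'k \<Rightarrow> 'k \<Rightarrow> 'k"
    using assms(1) vector_space_mult by (simp add: vector_space_pair_def)
  have "V.vs1.independent {v - w}"
    using assms(2) by simp
  then obtain \<phi> where \<phi>: "Vector_Spaces.linear s (*) \<phi>" "\<phi> (v - w) = 1"
    using V.linear_independent_extend[of "{v - w}" "\<lambda>_. 1"] by auto
  then have "\<phi> v - \<phi> w = 1"
    by (metis V.linear_diff)
  then have "\<phi> v \<noteq> \<phi> w" by auto
  with \<phi>(1) show ?thesis by blast
qed

lemma functional_lift:
  fixes e :: "'i \<Rightarrow> 'x \<Rightarrow> 'k::field" and f :: "'i \<Rightarrow> 'v::ab_group_add"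
  assumes s: "vector_space s"
    and sep: "\<And>\<phi>. Vector_Spaces.linear s (*) \<phi> \<Longrightarrow> \<exists>F. \<forall>i. e i F = \<phi> (f i)"
  shows "\<exists>g. Vector_Spaces.linear fscale s g \<and> (\<forall>i. g (e i) = f i)"
proof -
  interpret V: vector_space_pair "fscale :: 'k \<Rightarrow> ('x \<Rightarrow> 'k) \<Rightarrow> _" s
    using s vector_space_fscale by (simp add: vector_space_pair_def)
  obtain B where B: "B \<subseteq> range e" "V.vs1.independent B" "range e \<subseteq> V.vs1.span B"
    using V.vs1.maximal_independent_subset[of "range e"] by blast
  define h where "h b = f (SOME i. e i = b)" for b
  obtain g where g: "Vector_Spaces.linear fscale s g" "\<forall>b\<in>B. g b = h b"
    using V.linear_independent_extend[OF B(2)] by blast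
  have "g (e i) = f i" for i
  proof (rule ccontr)
    assume "g (e i) \<noteq> f i"
    then obtain \<phi> where \<phi>: "Vector_Spaces.linear s (*) \<phi>" "\<phi> (g (e i)) \<noteq> \<phi> (f i)"
      using linear_functional_separates[OF s] by blast
    obtain F where F: "\<And>i. e i F = \<phi> (f i)"
      using sep[OF \<phi>(1)] by blast
    interpret W: vector_space_pair "fscale :: 'k \<Rightarrow> ('x \<Rightarrow> 'k) \<Rightarrow> _" "(*) :: 'k \<Rightarrow> 'k \<Rightarrow> 'k"
      using vector_space_fscale vector_space_mult by (simp add: vector_space_pair_def)
    have lin: "Vector_Spaces.linear fscale (*) (\<phi> \<circ> g)"
      using g(1) \<phi>(1) by (auto simp: linear_field_iff)
    have "(\<phi> \<circ> g) b = b F" if "b \<in> B" for b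
    proof -
      have "e (SOME i. e i = b) = b"
        using that B(1) by (metis (mono_tags, lifting) imageE someI subsetD)
      then show ?thesis using g(2) that F by (metis comp_apply h_def)
    qed
    then have "(\<phi> \<circ> g) (e i) = e i F"
      using W.linear_eq_on[OF lin linear_eval, of "e i" B] B(3) by blast
    then show False using F \<phi>(2) by simp
  qed
  with g(1) show ?thesis by blast
qed

lemma linear_functional_unique:
  fixes g :: "('x \<Rightarrow> 'k::field) \<Rightarrow> 'v::ab_group_add"
  assumes "Vector_Spaces.linear fscale s g" "Vector_Spaces.linear fscale s g'"
    and "\<And>b. b \<in> B \<Longrightarrow> g b = g' b" and "t \<in> module.span fscale B"
  shows "g t = g' t"
proof -
  interpret V: vector_space_pair "fscale :: 'k \<Rightarrow> ('x \<Rightarrow> 'k) \<Rightarrow> _" s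
    using assms(1) by (simp add: linear_field_iff vector_space_pair_def)
  show ?thesis using V.linear_eq_on assms by blast
qed

lemma bilinear_map_compose:
  assumes "bilinear_map s1 s2 s f" "Vector_Spaces.linear s s' \<phi>"
  shows "bilinear_map s1 s2 s' (\<lambda>x y. \<phi> (f x y))"
  using assms by (simp add: bilinear_map_def linear_field_iff)

lemma trilinear_map_compose:
  assumes "trilinear_map s1 s2 s3 s f" "Vector_Spaces.linear s s' \<phi>"
  shows "trilinear_map s1 s2 s3 s' (\<lambda>x y z. \<phi> (f x y z))"
  using assms by (auto simp: trilinear_map_def intro: bilinear_map_compose)

lemma bilinear_map_tensor:
  assumes "vector_space s1" "vector_space s2"
  shows "bilinear_map s1 s2 fscale (tensor s1 s2)"
  using assms vector_space_fscale
  by (auto simp: bilinear_map_def linear_field_iff tensor_def fscale_def fun_eq_iff)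

lemma trilinear_map_tensor3:
  assumes "vector_space s1" "vector_space s2" "vector_space s3"
  shows "trilinear_map s1 s2 s3 fscale (tensor3 s1 s2 s3)"
  using assms vector_space_fscale
  by (auto simp: trilinear_map_def bilinear_map_def linear_field_iff tensor3_def fscale_def
      fun_eq_iff)

theorem tensor_universal:
  assumes "bilinear_map s1 s2 s f"
  shows "\<exists>g. Vector_Spaces.linear fscale s g \<and> (\<forall>x y. g (tensor s1 s2 x y) = f x y)"
    and "\<lbrakk>Vector_Spaces.linear fscale s g; \<forall>x y. g (tensor s1 s2 x y) = f x y;
          Vector_Spaces.linear fscale s g'; \<forall>x y. g' (tensor s1 s2 x y) = f x y;
          t \<in> tensor_space s1 s2\<rbrakk> \<Longrightarrow> g t = g' t"
proof -
  have "vector_space s"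
    using assms by (auto simp: bilinear_map_def linear_field_iff)
  moreover have "\<exists>F. \<forall>i. (\<lambda>(x, y). tensor s1 s2 x y) i F = \<phi> ((\<lambda>(x, y). f x y) i)"
    if "Vector_Spaces.linear s (*) \<phi>" for \<phi>
    using bilinear_map_compose[OF assms that] by (intro exI) (auto simp: tensor_def)
  ultimately show "\<exists>g. Vector_Spaces.linear fscale s g \<and> (\<forall>x y. g (tensor s1 s2 x y) = f x y)"
    using functional_lift[of s "\<lambda>(x, y). tensor s1 s2 x y" "\<lambda>(x, y). f x y"] by auto
  show "g t = g' t" if "Vector_Spaces.linear fscale s g" "\<forall>x y. g (tensor s1 s2 x y) = f x y"
      "Vector_Spaces.linear fscale s g'" "\<forall>x y. g' (tensor s1 s2 x y) = f x y"
      "t \<in> tensor_space s1 s2"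
    by (rule linear_functional_unique[OF that(1,3) _ that(5)[unfolded tensor_space_def]])
      (use that in auto)
qed

theorem tensor3_universal:
  assumes "trilinear_map s1 s2 s3 s f"
  shows "\<exists>g. Vector_Spaces.linear fscale s g \<and> (\<forall>x y z. g (tensor3 s1 s2 s3 x y z) = f x y z)"
    and "\<lbrakk>Vector_Spaces.linear fscale s g; \<forall>x y z. g (tensor3 s1 s2 s3 x y z) = f x y z;
          Vector_Spaces.linear fscale s g'; \<forall>x y z. g' (tensor3 s1 s2 s3 x y z) = f x y z;
          t \<in> tensor3_space s1 s2 s3\<rbrakk> \<Longrightarrow> g t = g' t"
proof -
  have "vector_space s"
    using assms by (auto simp: trilinear_map_def bilinear_map_def linear_field_iff)
  moreover have "\<exists>F. \<forall>i. (\<lambda>(x, y, z). tensor3 s1 s2 s3 x y z) i F = \<phi> ((\<lambda>(x, y, z). f x y z) i)"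
    if "Vector_Spaces.linear s (*) \<phi>" for \<phi>
    using trilinear_map_compose[OF assms that] by (intro exI) (auto simp: tensor3_def)
  ultimately show
    "\<exists>g. Vector_Spaces.linear fscale s g \<and> (\<forall>x y z. g (tensor3 s1 s2 s3 x y z) = f x y z)"
    using functional_lift[of s "\<lambda>(x, y, z). tensor3 s1 s2 s3 x y z" "\<lambda>(x, y, z). f x y z"]
    by auto
  show "g t = g' t"
    if "Vector_Spaces.linear fscale s g" "\<forall>x y z. g (tensor3 s1 s2 s3 x y z) = f x y z"
      "Vector_Spaces.linear fscale s g'" "\<forall>x y z. g' (tensor3 s1 s2 s3 x y z) = f x y z"
      "t \<in> tensor3_space s1 s2 s3"
    by (rule linear_functional_unique[OF that(1,3) _ that(5)[unfolded tensor3_space_def]])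
      (use that in auto)
qed

text \<open>Tensors are linear as functionals on bilinear forms.\<close>

lemma tensor_space_form_linear:
  assumes t: "t \<in> tensor_space s1 s2"
    and F: "bilinear_map s1 s2 (*) F" and G: "bilinear_map s1 s2 (*) G"
  shows "t (\<lambda>x y. F x y + G x y) = t F + t G" and "t (\<lambda>x y. c * F x y) = c * t F"
proof -
  have FG: "bilinear_map s1 s2 (*) (\<lambda>x y. F x y + G x y)"
    "bilinear_map s1 s2 (*) (\<lambda>x y. c * F x y)"
    using F G by (auto simp: bilinear_map_def linear_field_iff algebra_simps)
  have lin: "Vector_Spaces.linear fscale (*) (\<lambda>t. t F + t G)"
    "Vector_Spaces.linear fscale (*) (\<lambda>t. c * t F)"
    by (simp_all add: linear_field_iff vector_space_mult vector_space_fscale fscale_def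
        algebra_simps)
  show "t (\<lambda>x y. F x y + G x y) = t F + t G"
    by (rule linear_functional_unique[OF linear_eval lin(1) _ t[unfolded tensor_space_def]])
      (use F G FG in \<open>auto simp: tensor_def\<close>)
  show "t (\<lambda>x y. c * F x y) = c * t F"
    by (rule linear_functional_unique[OF linear_eval lin(2) _ t[unfolded tensor_space_def]])
      (use F FG in \<open>auto simp: tensor_def\<close>)
qed

lemma linear_tensor_maps:
  "Vector_Spaces.linear fscale fscale (tensor_map s1 s2 f g)"
  "Vector_Spaces.linear fscale fscale (tensor_map_left s1 s2 s3 D g)"
  "Vector_Spaces.linear fscale fscale (tensor_map_right s1 s2 s3 f D)"
  by (auto simp: linear_field_iff vector_space_fscale fscale_def fun_eq_iff
      tensor_map_def tensor_map_left_def tensor_map_right_def)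

lemma tensor_map_tensor:
  assumes "Vector_Spaces.linear s1 s1' f" "Vector_Spaces.linear s2 s2' g"
  shows "tensor_map s1' s2' f g (tensor s1 s2 x y) = tensor s1' s2' (f x) (g y)"
  using assms
  by (auto simp: tensor_map_def tensor_def bilinear_map_def linear_field_iff fun_eq_iff)

lemma bilinear_map_left_form:
  assumes D: "linear_to_tensor s s1 s2 D" and g: "Vector_Spaces.linear s' s3 g"
    and F: "trilinear_map s1 s2 s3 (*) F"
  shows "bilinear_map s s' (*) (\<lambda>x y. D x (\<lambda>u v. F u v (g y)))"
proof -
  have Dx: "D x \<in> tensor_space s1 s2" for x
    using D by (auto simp: linear_to_tensor_def)
  have Fz: "bilinear_map s1 s2 (*) (\<lambda>u v. F u v z)" for z
    using F by (simp add: trilinear_map_def)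
  have "F u v (z + z') = F u v z + F u v z'" "F u v (s3 c z) = c * F u v z" for u v z z' c
    using F by (auto simp: trilinear_map_def bilinear_map_def linear_field_iff)
  then show ?thesis
    using D g tensor_space_form_linear[OF Dx Fz Fz]
    by (auto simp: bilinear_map_def linear_to_tensor_def linear_field_iff fscale_def
        vector_space_mult)
qed

lemma bilinear_map_right_form:
  assumes f: "Vector_Spaces.linear s s1 f" and D: "linear_to_tensor s' s2 s3 D"
    and F: "trilinear_map s1 s2 s3 (*) F"
  shows "bilinear_map s s' (*) (\<lambda>x y. D y (\<lambda>u v. F (f x) u v))"
proof -
  have Dx: "D x \<in> tensor_space s2 s3" for x
    using D by (auto simp: linear_to_tensor_def)
  have Fz: "bilinear_map s2 s3 (*) (\<lambda>u v. F z u v)" for z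
    using F by (simp add: trilinear_map_def)
  have "F (z + z') = (\<lambda>u v. F z u v + F z' u v)" "F (s1 c z) = (\<lambda>u v. c * F z u v)" for z z' c
    using F by (auto simp: trilinear_map_def bilinear_map_def linear_field_iff fun_eq_iff)
  then show ?thesis
    using D f tensor_space_form_linear[OF Dx Fz Fz]
    by (auto simp: bilinear_map_def linear_to_tensor_def linear_field_iff fscale_def
        vector_space_mult)
qed

lemma sum_fun_apply: "(\<Sum>i\<in>I. t i) F = (\<Sum>i\<in>I. t i F :: 'k::comm_monoid_add)"
  by (induction I rule: infinite_finite_induct) auto

lemma tensor_map_left_tensor:
  assumes "linear_to_tensor s s1 s2 D" "Vector_Spaces.linear s' s3 g"
    and "D x = (\<Sum>i\<in>I. tensor s1 s2 (u i) (v i))"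
  shows "tensor_map_left s1 s2 s3 D g (tensor s s' x y) =
    (\<Sum>i\<in>I. tensor3 s1 s2 s3 (u i) (v i) (g y))"
proof (rule ext)
  fix F
  show "tensor_map_left s1 s2 s3 D g (tensor s s' x y) F =
    (\<Sum>i\<in>I. tensor3 s1 s2 s3 (u i) (v i) (g y)) F"
  proof (cases "trilinear_map s1 s2 s3 (*) F")
    case True
    then have "bilinear_map s1 s2 (*) (\<lambda>u v. F u v (g y))"
      by (simp add: trilinear_map_def)
    with True bilinear_map_left_form[OF assms(1,2) True] assms(3) show ?thesis
      by (simp add: tensor_map_left_def tensor_def[of s s'] sum_fun_apply tensor3_def
          tensor_def[of s1 s2])
  qed (simp add: tensor_map_left_def tensor3_def sum_fun_apply)
qed

lemma tensor_map_right_tensor: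
  assumes "Vector_Spaces.linear s s1 f" "linear_to_tensor s' s2 s3 D"
    and "D y = (\<Sum>i\<in>I. tensor s2 s3 (u i) (v i))"
  shows "tensor_map_right s1 s2 s3 f D (tensor s s' x y) =
    (\<Sum>i\<in>I. tensor3 s1 s2 s3 (f x) (u i) (v i))"
proof (rule ext)
  fix F
  show "tensor_map_right s1 s2 s3 f D (tensor s s' x y) F =
    (\<Sum>i\<in>I. tensor3 s1 s2 s3 (f x) (u i) (v i)) F"
  proof (cases "trilinear_map s1 s2 s3 (*) F")
    case True
    then have "bilinear_map s2 s3 (*) (\<lambda>u v. F (f x) u v)"
      by (simp add: trilinear_map_def)
    with True bilinear_map_right_form[OF assms(1,2) True] assms(3) show ?thesis
      by (simp add: tensor_map_right_def tensor_def[of s s'] sum_fun_apply tensor3_def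
          tensor_def[of s2 s3])
  qed (simp add: tensor_map_right_def tensor3_def sum_fun_apply)
qed


section \<open>BiHom-structures\<close>

definition pairwise_commuting :: "('a \<Rightarrow> 'a) set \<Rightarrow> bool" where
  "pairwise_commuting S \<longleftrightarrow> (\<forall>f\<in>S. \<forall>g\<in>S. f \<circ> g = g \<circ> f)"

definition multiplicative :: "('a \<Rightarrow> 'a \<Rightarrow> 'a) \<Rightarrow> ('a \<Rightarrow> 'a) \<Rightarrow> bool" where
  "multiplicative \<mu> f \<longleftrightarrow> (\<forall>a b. f (\<mu> a b) = \<mu> (f a) (f b))"

definition comultiplicative ::
  "('k::field \<Rightarrow> 'a::ab_group_add \<Rightarrow> 'a) \<Rightarrow> ('a \<Rightarrow> ('a, 'a, 'k) tensor) \<Rightarrow> ('a \<Rightarrow> 'a) \<Rightarrow> bool" where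
  "comultiplicative s \<Delta> f \<longleftrightarrow> (\<forall>a. tensor_map s s f f (\<Delta> a) = \<Delta> (f a))"

definition bihom_associative ::
  "('k::field \<Rightarrow> 'a::ab_group_add \<Rightarrow> 'a) \<Rightarrow> ('a \<Rightarrow> 'a \<Rightarrow> 'a) \<Rightarrow> ('a \<Rightarrow> 'a) \<Rightarrow> ('a \<Rightarrow> 'a) \<Rightarrow> bool" where
  "bihom_associative s \<mu> \<alpha> \<beta> \<longleftrightarrow>
     bilinear_map s s s \<mu> \<and> Vector_Spaces.linear s s \<alpha> \<and> Vector_Spaces.linear s s \<beta> \<and>
     \<alpha> \<circ> \<beta> = \<beta> \<circ> \<alpha> \<and> multiplicative \<mu> \<alpha> \<and> multiplicative \<mu> \<beta> \<and>
     (\<forall>a b c. \<mu> (\<alpha> a) (\<mu> b c) = \<mu> (\<mu> a b) (\<beta> c))"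

definition bihom_coassociative ::
  "('k::field \<Rightarrow> 'a::ab_group_add \<Rightarrow> 'a) \<Rightarrow> ('a \<Rightarrow> ('a, 'a, 'k) tensor) \<Rightarrow>
   ('a \<Rightarrow> 'a) \<Rightarrow> ('a \<Rightarrow> 'a) \<Rightarrow> bool" where
  "bihom_coassociative s \<Delta> \<psi> \<omega> \<longleftrightarrow>
     linear_to_tensor s s s \<Delta> \<and> Vector_Spaces.linear s s \<psi> \<and> Vector_Spaces.linear s s \<omega> \<and>
     \<psi> \<circ> \<omega> = \<omega> \<circ> \<psi> \<and> comultiplicative s \<Delta> \<psi> \<and> comultiplicative s \<Delta> \<omega> \<and>
     (\<forall>c. tensor_map_left s s s \<Delta> \<psi> (\<Delta> c) = tensor_map_right s s s \<omega> \<Delta> (\<Delta> c))"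

definition infBH_bialgebra ::
  "('k::field \<Rightarrow> 'a::ab_group_add \<Rightarrow> 'a) \<Rightarrow> 'k \<Rightarrow> ('a \<Rightarrow> 'a \<Rightarrow> 'a) \<Rightarrow> ('a \<Rightarrow> ('a, 'a, 'k) tensor) \<Rightarrow>
   ('a \<Rightarrow> 'a) \<Rightarrow> ('a \<Rightarrow> 'a) \<Rightarrow> ('a \<Rightarrow> 'a) \<Rightarrow> ('a \<Rightarrow> 'a) \<Rightarrow> bool" where
  "infBH_bialgebra s l \<mu> \<Delta> \<alpha> \<beta> \<psi> \<omega> \<longleftrightarrow>
     bihom_associative s \<mu> \<alpha> \<beta> \<and> bihom_coassociative s \<Delta> \<psi> \<omega> \<and>
     (\<forall>f\<in>{\<alpha>, \<beta>}. \<forall>g\<in>{\<psi>, \<omega>}. f \<circ> g = g \<circ> f) \<and>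
     comultiplicative s \<Delta> \<alpha> \<and> comultiplicative s \<Delta> \<beta> \<and>
     multiplicative \<mu> \<psi> \<and> multiplicative \<mu> \<omega> \<and>
     (\<forall>a b. \<Delta> (\<mu> a b) =
        tensor_map s s (\<lambda>b1. \<mu> (\<omega> a) b1) \<beta> (\<Delta> b) +
        tensor_map s s \<alpha> (\<lambda>a2. \<mu> a2 (\<psi> b)) (\<Delta> a) +
        fscale l (tensor s s (\<alpha> (\<omega> a)) (\<beta> (\<psi> b))))"


subsection \<open>Modules\<close>

text \<open>
  The structure maps of the acting (co)algebra carry the suffix \<open>A\<close>, those of the
  (co)module the suffix \<open>M\<close>; \<open>L\<close> and \<open>R\<close> are the left action \<open>a \<triangleright> m = L a m\<close> and the right
  action \<open>m \<triangleleft> a = R m a\<close>.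
\<close>

definition left_bihom_module ::
  "('k::field \<Rightarrow> 'a::ab_group_add \<Rightarrow> 'a) \<Rightarrow> ('a \<Rightarrow> 'a \<Rightarrow> 'a) \<Rightarrow> ('a \<Rightarrow> 'a) \<Rightarrow> ('a \<Rightarrow> 'a) \<Rightarrow>
   ('k \<Rightarrow> 'm::ab_group_add \<Rightarrow> 'm) \<Rightarrow> ('a \<Rightarrow> 'm \<Rightarrow> 'm) \<Rightarrow> ('m \<Rightarrow> 'm) \<Rightarrow> ('m \<Rightarrow> 'm) \<Rightarrow> bool" where
  "left_bihom_module sA \<mu> \<alpha>A \<beta>A sM L \<alpha>M \<beta>M \<longleftrightarrow>
     bihom_associative sA \<mu> \<alpha>A \<beta>A \<and> bilinear_map sA sM sM L \<and>
     Vector_Spaces.linear sM sM \<alpha>M \<and> Vector_Spaces.linear sM sM \<beta>M \<and>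
     \<alpha>M \<circ> \<beta>M = \<beta>M \<circ> \<alpha>M \<and>
     (\<forall>a m. \<alpha>M (L a m) = L (\<alpha>A a) (\<alpha>M m)) \<and>
     (\<forall>a m. \<beta>M (L a m) = L (\<beta>A a) (\<beta>M m)) \<and>
     (\<forall>a a' m. L (\<alpha>A a) (L a' m) = L (\<mu> a a') (\<beta>M m))"

definition right_bihom_module ::
  "('k::field \<Rightarrow> 'a::ab_group_add \<Rightarrow> 'a) \<Rightarrow> ('a \<Rightarrow> 'a \<Rightarrow> 'a) \<Rightarrow> ('a \<Rightarrow> 'a) \<Rightarrow> ('a \<Rightarrow> 'a) \<Rightarrow>
   ('k \<Rightarrow> 'm::ab_group_add \<Rightarrow> 'm) \<Rightarrow> ('m \<Rightarrow> 'a \<Rightarrow> 'm) \<Rightarrow> ('m \<Rightarrow> 'm) \<Rightarrow> ('m \<Rightarrow> 'm) \<Rightarrow> bool" where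
  "right_bihom_module sA \<mu> \<alpha>A \<beta>A sM R \<alpha>M \<beta>M \<longleftrightarrow>
     bihom_associative sA \<mu> \<alpha>A \<beta>A \<and> bilinear_map sM sA sM R \<and>
     Vector_Spaces.linear sM sM \<alpha>M \<and> Vector_Spaces.linear sM sM \<beta>M \<and>
     \<alpha>M \<circ> \<beta>M = \<beta>M \<circ> \<alpha>M \<and>
     (\<forall>m a. \<alpha>M (R m a) = R (\<alpha>M m) (\<alpha>A a)) \<and>
     (\<forall>m a. \<beta>M (R m a) = R (\<beta>M m) (\<beta>A a)) \<and>
     (\<forall>m a a'. R (\<alpha>M m) (\<mu> a a') = R (R m a) (\<beta>A a'))"

definition bihom_bimodule ::
  "('k::field \<Rightarrow> 'a::ab_group_add \<Rightarrow> 'a) \<Rightarrow> ('a \<Rightarrow> 'a \<Rightarrow> 'a) \<Rightarrow> ('a \<Rightarrow> 'a) \<Rightarrow> ('a \<Rightarrow> 'a) \<Rightarrow>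
   ('k \<Rightarrow> 'm::ab_group_add \<Rightarrow> 'm) \<Rightarrow> ('a \<Rightarrow> 'm \<Rightarrow> 'm) \<Rightarrow> ('m \<Rightarrow> 'a \<Rightarrow> 'm) \<Rightarrow>
   ('m \<Rightarrow> 'm) \<Rightarrow> ('m \<Rightarrow> 'm) \<Rightarrow> bool" where
  "bihom_bimodule sA \<mu> \<alpha>A \<beta>A sM L R \<alpha>M \<beta>M \<longleftrightarrow>
     left_bihom_module sA \<mu> \<alpha>A \<beta>A sM L \<alpha>M \<beta>M \<and>
     right_bihom_module sA \<mu> \<alpha>A \<beta>A sM R \<alpha>M \<beta>M \<and>
     (\<forall>a m a'. L (\<alpha>A a) (R m a') = R (L a m) (\<beta>A a'))"

definition bihom_bimodule_algebra ::
  "('k::field \<Rightarrow> 'a::ab_group_add \<Rightarrow> 'a) \<Rightarrow> ('a \<Rightarrow> 'a \<Rightarrow> 'a) \<Rightarrow> ('a \<Rightarrow> 'a) \<Rightarrow> ('a \<Rightarrow> 'a) \<Rightarrow>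
   ('k \<Rightarrow> 'm::ab_group_add \<Rightarrow> 'm) \<Rightarrow> ('m \<Rightarrow> 'm \<Rightarrow> 'm) \<Rightarrow> ('a \<Rightarrow> 'm \<Rightarrow> 'm) \<Rightarrow> ('m \<Rightarrow> 'a \<Rightarrow> 'm) \<Rightarrow>
   ('m \<Rightarrow> 'm) \<Rightarrow> ('m \<Rightarrow> 'm) \<Rightarrow> bool" where
  "bihom_bimodule_algebra sA \<mu> \<alpha>A \<beta>A sM \<mu>M L R \<alpha>M \<beta>M \<longleftrightarrow>
     bihom_bimodule sA \<mu> \<alpha>A \<beta>A sM L R \<alpha>M \<beta>M \<and>
     bihom_associative sM \<mu>M \<alpha>M \<beta>M \<and>
     (\<forall>a m n. L (\<alpha>A a) (\<mu>M m n) = \<mu>M (L a m) (\<beta>M n)) \<and>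
     (\<forall>m n a. \<mu>M (\<alpha>M m) (R n a) = R (\<mu>M m n) (\<beta>A a)) \<and>
     (\<forall>m a n. \<mu>M (\<alpha>M m) (L a n) = \<mu>M (R m a) (\<beta>M n))"


subsection \<open>Comodules\<close>

definition left_bihom_comodule ::
  "('k::field \<Rightarrow> 'a::ab_group_add \<Rightarrow> 'a) \<Rightarrow> ('a \<Rightarrow> ('a, 'a, 'k) tensor) \<Rightarrow> ('a \<Rightarrow> 'a) \<Rightarrow> ('a \<Rightarrow> 'a) \<Rightarrow>
   ('k \<Rightarrow> 'm::ab_group_add \<Rightarrow> 'm) \<Rightarrow> ('m \<Rightarrow> ('a, 'm, 'k) tensor) \<Rightarrow>
   ('m \<Rightarrow> 'm) \<Rightarrow> ('m \<Rightarrow> 'm) \<Rightarrow> bool" where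
  "left_bihom_comodule sA \<Delta> \<psi>A \<omega>A sM \<rho> \<psi>M \<omega>M \<longleftrightarrow>
     bihom_coassociative sA \<Delta> \<psi>A \<omega>A \<and> linear_to_tensor sM sA sM \<rho> \<and>
     Vector_Spaces.linear sM sM \<psi>M \<and> Vector_Spaces.linear sM sM \<omega>M \<and>
     \<psi>M \<circ> \<omega>M = \<omega>M \<circ> \<psi>M \<and>
     (\<forall>m. tensor_map sA sM \<psi>A \<psi>M (\<rho> m) = \<rho> (\<psi>M m)) \<and>
     (\<forall>m. tensor_map sA sM \<omega>A \<omega>M (\<rho> m) = \<rho> (\<omega>M m)) \<and>
     (\<forall>m. tensor_map_right sA sA sM \<omega>A \<rho> (\<rho> m) = tensor_map_left sA sA sM \<Delta> \<psi>M (\<rho> m))"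

definition right_bihom_comodule ::
  "('k::field \<Rightarrow> 'a::ab_group_add \<Rightarrow> 'a) \<Rightarrow> ('a \<Rightarrow> ('a, 'a, 'k) tensor) \<Rightarrow> ('a \<Rightarrow> 'a) \<Rightarrow> ('a \<Rightarrow> 'a) \<Rightarrow>
   ('k \<Rightarrow> 'm::ab_group_add \<Rightarrow> 'm) \<Rightarrow> ('m \<Rightarrow> ('m, 'a, 'k) tensor) \<Rightarrow>
   ('m \<Rightarrow> 'm) \<Rightarrow> ('m \<Rightarrow> 'm) \<Rightarrow> bool" where
  "right_bihom_comodule sA \<Delta> \<psi>A \<omega>A sM \<phi> \<psi>M \<omega>M \<longleftrightarrow>
     bihom_coassociative sA \<Delta> \<psi>A \<omega>A \<and> linear_to_tensor sM sM sA \<phi> \<and>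
     Vector_Spaces.linear sM sM \<psi>M \<and> Vector_Spaces.linear sM sM \<omega>M \<and>
     \<psi>M \<circ> \<omega>M = \<omega>M \<circ> \<psi>M \<and>
     (\<forall>m. tensor_map sM sA \<psi>M \<psi>A (\<phi> m) = \<phi> (\<psi>M m)) \<and>
     (\<forall>m. tensor_map sM sA \<omega>M \<omega>A (\<phi> m) = \<phi> (\<omega>M m)) \<and>
     (\<forall>m. tensor_map_right sM sA sA \<omega>M \<Delta> (\<phi> m) = tensor_map_left sM sA sA \<phi> \<psi>A (\<phi> m))"

definition bihom_bicomodule ::
  "('k::field \<Rightarrow> 'a::ab_group_add \<Rightarrow> 'a) \<Rightarrow> ('a \<Rightarrow> ('a, 'a, 'k) tensor) \<Rightarrow> ('a \<Rightarrow> 'a) \<Rightarrow> ('a \<Rightarrow> 'a) \<Rightarrow>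
   ('k \<Rightarrow> 'm::ab_group_add \<Rightarrow> 'm) \<Rightarrow> ('m \<Rightarrow> ('a, 'm, 'k) tensor) \<Rightarrow> ('m \<Rightarrow> ('m, 'a, 'k) tensor) \<Rightarrow>
   ('m \<Rightarrow> 'm) \<Rightarrow> ('m \<Rightarrow> 'm) \<Rightarrow> bool" where
  "bihom_bicomodule sA \<Delta> \<psi>A \<omega>A sM \<rho> \<phi> \<psi>M \<omega>M \<longleftrightarrow>
     left_bihom_comodule sA \<Delta> \<psi>A \<omega>A sM \<rho> \<psi>M \<omega>M \<and>
     right_bihom_comodule sA \<Delta> \<psi>A \<omega>A sM \<phi> \<psi>M \<omega>M \<and>
     (\<forall>m. tensor_map_right sA sM sA \<omega>A \<phi> (\<rho> m) = tensor_map_left sA sM sA \<rho> \<psi>A (\<phi> m))"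

definition bihom_bicomodule_coalgebra ::
  "('k::field \<Rightarrow> 'a::ab_group_add \<Rightarrow> 'a) \<Rightarrow> ('a \<Rightarrow> ('a, 'a, 'k) tensor) \<Rightarrow> ('a \<Rightarrow> 'a) \<Rightarrow> ('a \<Rightarrow> 'a) \<Rightarrow>
   ('k \<Rightarrow> 'm::ab_group_add \<Rightarrow> 'm) \<Rightarrow> ('m \<Rightarrow> ('m, 'm, 'k) tensor) \<Rightarrow>
   ('m \<Rightarrow> ('a, 'm, 'k) tensor) \<Rightarrow> ('m \<Rightarrow> ('m, 'a, 'k) tensor) \<Rightarrow>
   ('m \<Rightarrow> 'm) \<Rightarrow> ('m \<Rightarrow> 'm) \<Rightarrow> bool" where
  "bihom_bicomodule_coalgebra sA \<Delta> \<psi>A \<omega>A sM \<Delta>M \<rho> \<phi> \<psi>M \<omega>M \<longleftrightarrow>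
     bihom_bicomodule sA \<Delta> \<psi>A \<omega>A sM \<rho> \<phi> \<psi>M \<omega>M \<and>
     bihom_coassociative sM \<Delta>M \<psi>M \<omega>M \<and>
     (\<forall>m. tensor_map_right sA sM sM \<omega>A \<Delta>M (\<rho> m) = tensor_map_left sA sM sM \<rho> \<psi>M (\<Delta>M m)) \<and>
     (\<forall>m. tensor_map_right sM sM sA \<omega>M \<phi> (\<Delta>M m) = tensor_map_left sM sM sA \<Delta>M \<psi>A (\<phi> m)) \<and>
     (\<forall>m. tensor_map_right sM sA sM \<omega>M \<rho> (\<Delta>M m) = tensor_map_left sM sA sM \<phi> \<psi>M (\<Delta>M m))"


subsection \<open>Mixed structures\<close>

definition infBH_Hopf_bimodule ::
  "('k::field \<Rightarrow> 'a::ab_group_add \<Rightarrow> 'a) \<Rightarrow> 'k \<Rightarrow> ('a \<Rightarrow> 'a \<Rightarrow> 'a) \<Rightarrow> ('a \<Rightarrow> ('a, 'a, 'k) tensor) \<Rightarrow>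
   ('a \<Rightarrow> 'a) \<Rightarrow> ('a \<Rightarrow> 'a) \<Rightarrow> ('a \<Rightarrow> 'a) \<Rightarrow> ('a \<Rightarrow> 'a) \<Rightarrow>
   ('k \<Rightarrow> 'm::ab_group_add \<Rightarrow> 'm) \<Rightarrow> ('a \<Rightarrow> 'm \<Rightarrow> 'm) \<Rightarrow> ('m \<Rightarrow> 'a \<Rightarrow> 'm) \<Rightarrow>
   ('m \<Rightarrow> ('a, 'm, 'k) tensor) \<Rightarrow> ('m \<Rightarrow> ('m, 'a, 'k) tensor) \<Rightarrow>
   ('m \<Rightarrow> 'm) \<Rightarrow> ('m \<Rightarrow> 'm) \<Rightarrow> ('m \<Rightarrow> 'm) \<Rightarrow> ('m \<Rightarrow> 'm) \<Rightarrow> bool" where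
  "infBH_Hopf_bimodule sA l \<mu> \<Delta> \<alpha>A \<beta>A \<psi>A \<omega>A sM L R \<rho> \<phi> \<alpha>M \<beta>M \<psi>M \<omega>M \<longleftrightarrow>
     infBH_bialgebra sA l \<mu> \<Delta> \<alpha>A \<beta>A \<psi>A \<omega>A \<and>
     pairwise_commuting {\<alpha>M, \<beta>M, \<psi>M, \<omega>M} \<and>
     bihom_bimodule sA \<mu> \<alpha>A \<beta>A sM L R \<alpha>M \<beta>M \<and>
     bihom_bicomodule sA \<Delta> \<psi>A \<omega>A sM \<rho> \<phi> \<psi>M \<omega>M \<and>
     (\<forall>a m. \<rho> (L a m) =
        tensor_map sA sM (\<lambda>b. \<mu> (\<omega>A a) b) \<beta>M (\<rho> m) +
        tensor_map sA sM \<alpha>A (\<lambda>a2. L a2 (\<psi>M m)) (\<Delta> a) +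
        fscale l (tensor sA sM (\<alpha>A (\<omega>A a)) (\<beta>M (\<psi>M m)))) \<and>
     (\<forall>m a. \<phi> (R m a) =
        tensor_map sM sA (\<lambda>a1. R (\<omega>M m) a1) \<beta>A (\<Delta> a) +
        tensor_map sM sA \<alpha>M (\<lambda>b. \<mu> b (\<psi>A a)) (\<phi> m) +
        fscale l (tensor sM sA (\<alpha>M (\<omega>M m)) (\<beta>A (\<psi>A a)))) \<and>
     (\<forall>a m. \<phi> (L a m) = tensor_map sM sA (\<lambda>m0. L (\<omega>A a) m0) \<beta>A (\<phi> m)) \<and>
     (\<forall>m a. \<rho> (R m a) = tensor_map sA sM \<alpha>A (\<lambda>m0. R m0 (\<psi>A a)) (\<rho> m))"

definition bihom_bimodule_coalgebra ::
  "('k::field \<Rightarrow> 'a::ab_group_add \<Rightarrow> 'a) \<Rightarrow> ('a \<Rightarrow> 'a \<Rightarrow> 'a) \<Rightarrow>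
   ('a \<Rightarrow> 'a) \<Rightarrow> ('a \<Rightarrow> 'a) \<Rightarrow> ('a \<Rightarrow> 'a) \<Rightarrow> ('a \<Rightarrow> 'a) \<Rightarrow>
   ('k \<Rightarrow> 'm::ab_group_add \<Rightarrow> 'm) \<Rightarrow> ('m \<Rightarrow> ('m, 'm, 'k) tensor) \<Rightarrow>
   ('a \<Rightarrow> 'm \<Rightarrow> 'm) \<Rightarrow> ('m \<Rightarrow> 'a \<Rightarrow> 'm) \<Rightarrow>
   ('m \<Rightarrow> 'm) \<Rightarrow> ('m \<Rightarrow> 'm) \<Rightarrow> ('m \<Rightarrow> 'm) \<Rightarrow> ('m \<Rightarrow> 'm) \<Rightarrow> bool" where
  "bihom_bimodule_coalgebra sA \<mu> \<alpha>A \<beta>A \<psi>A \<omega>A sM \<Delta>M L R \<alpha>M \<beta>M \<psi>M \<omega>M \<longleftrightarrow>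
     bihom_bimodule sA \<mu> \<alpha>A \<beta>A sM L R \<alpha>M \<beta>M \<and>
     bihom_coassociative sM \<Delta>M \<psi>M \<omega>M \<and>
     pairwise_commuting {\<alpha>M, \<beta>M, \<psi>M, \<omega>M} \<and>
     comultiplicative sM \<Delta>M \<alpha>M \<and> comultiplicative sM \<Delta>M \<beta>M \<and>
     (\<forall>a m. \<psi>M (L a m) = L (\<psi>A a) (\<psi>M m)) \<and>
     (\<forall>m a. \<psi>M (R m a) = R (\<psi>M m) (\<psi>A a)) \<and>
     (\<forall>a m. \<omega>M (L a m) = L (\<omega>A a) (\<omega>M m)) \<and>
     (\<forall>m a. \<omega>M (R m a) = R (\<omega>M m) (\<omega>A a)) \<and>
     (\<forall>a m. \<Delta>M (L a m) = tensor_map sM sM (\<lambda>m1. L (\<omega>A a) m1) \<beta>M (\<Delta>M m)) \<and>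
     (\<forall>m a. \<Delta>M (R m a) = tensor_map sM sM \<alpha>M (\<lambda>m2. R m2 (\<psi>A a)) (\<Delta>M m))"

definition bihom_bicomodule_algebra ::
  "('k::field \<Rightarrow> 'a::ab_group_add \<Rightarrow> 'a) \<Rightarrow> ('a \<Rightarrow> ('a, 'a, 'k) tensor) \<Rightarrow>
   ('a \<Rightarrow> 'a) \<Rightarrow> ('a \<Rightarrow> 'a) \<Rightarrow> ('a \<Rightarrow> 'a) \<Rightarrow> ('a \<Rightarrow> 'a) \<Rightarrow>
   ('k \<Rightarrow> 'm::ab_group_add \<Rightarrow> 'm) \<Rightarrow> ('m \<Rightarrow> 'm \<Rightarrow> 'm) \<Rightarrow>
   ('m \<Rightarrow> ('a, 'm, 'k) tensor) \<Rightarrow> ('m \<Rightarrow> ('m, 'a, 'k) tensor) \<Rightarrow>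
   ('m \<Rightarrow> 'm) \<Rightarrow> ('m \<Rightarrow> 'm) \<Rightarrow> ('m \<Rightarrow> 'm) \<Rightarrow> ('m \<Rightarrow> 'm) \<Rightarrow> bool" where
  "bihom_bicomodule_algebra sA \<Delta> \<alpha>A \<beta>A \<psi>A \<omega>A sM \<mu>M \<rho> \<phi> \<alpha>M \<beta>M \<psi>M \<omega>M \<longleftrightarrow>
     bihom_bicomodule sA \<Delta> \<psi>A \<omega>A sM \<rho> \<phi> \<psi>M \<omega>M \<and>
     bihom_associative sM \<mu>M \<alpha>M \<beta>M \<and>
     pairwise_commuting {\<alpha>M, \<beta>M, \<psi>M, \<omega>M} \<and>
     multiplicative \<mu>M \<psi>M \<and> multiplicative \<mu>M \<omega>M \<and>
     (\<forall>m. tensor_map sA sM \<alpha>A \<alpha>M (\<rho> m) = \<rho> (\<alpha>M m)) \<and>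
     (\<forall>m. tensor_map sM sA \<alpha>M \<alpha>A (\<phi> m) = \<phi> (\<alpha>M m)) \<and>
     (\<forall>m. tensor_map sA sM \<beta>A \<beta>M (\<rho> m) = \<rho> (\<beta>M m)) \<and>
     (\<forall>m. tensor_map sM sA \<beta>M \<beta>A (\<phi> m) = \<phi> (\<beta>M m)) \<and>
     (\<forall>m n. \<rho> (\<mu>M m n) = tensor_map sA sM \<alpha>A (\<lambda>m0. \<mu>M m0 (\<psi>M n)) (\<rho> m)) \<and>
     (\<forall>m n. \<phi> (\<mu>M m n) = tensor_map sM sA (\<lambda>n0. \<mu>M (\<omega>M m) n0) \<beta>A (\<phi> n))"


subsection \<open>The direct sum\<close>

definition sum_mult ::
  "('a::ab_group_add \<Rightarrow> 'a \<Rightarrow> 'a) \<Rightarrow> ('m::ab_group_add \<Rightarrow> 'm \<Rightarrow> 'm) \<Rightarrow>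
   ('a \<Rightarrow> 'm \<Rightarrow> 'm) \<Rightarrow> ('m \<Rightarrow> 'a \<Rightarrow> 'm) \<Rightarrow> 'a \<times> 'm \<Rightarrow> 'a \<times> 'm \<Rightarrow> 'a \<times> 'm" where
  "sum_mult \<mu> \<mu>M L R = (\<lambda>(a, m) (b, n). (\<mu> a b, L a n + R m b + \<mu>M m n))"

text \<open>
  The four summands are transported to \<open>(A \<oplus> M) \<otimes> (A \<oplus> M)\<close> along the inclusions
  \<open>a \<mapsto> (a, 0)\<close> and \<open>m \<mapsto> (0, m)\<close>.
\<close>

definition sum_comult ::
  "('k::field \<Rightarrow> 'a::ab_group_add \<Rightarrow> 'a) \<Rightarrow> ('k \<Rightarrow> 'm::ab_group_add \<Rightarrow> 'm) \<Rightarrow>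
   ('a \<Rightarrow> ('a, 'a, 'k) tensor) \<Rightarrow> ('m \<Rightarrow> ('m, 'm, 'k) tensor) \<Rightarrow>
   ('m \<Rightarrow> ('a, 'm, 'k) tensor) \<Rightarrow> ('m \<Rightarrow> ('m, 'a, 'k) tensor) \<Rightarrow>
   'a \<times> 'm \<Rightarrow> ('a \<times> 'm, 'a \<times> 'm, 'k) tensor" where
  "sum_comult sA sM \<Delta> \<Delta>M \<rho> \<phi> = (\<lambda>(a, m).
     let s = module_prod.scale sA sM; iA = (\<lambda>a. (a, 0)); iM = (\<lambda>m. (0, m)) in
       tensor_map s s iA iA (\<Delta> a) + tensor_map s s iA iM (\<rho> m) +
       tensor_map s s iM iA (\<phi> m) + tensor_map s s iM iM (\<Delta>M m))"

end

theory Submission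
  imports Defs
begin

text \<open>
  A tensor on \<open>A \<oplus> M\<close> is determined by its four blocks in \<open>A \<otimes> A\<close>, \<open>A \<otimes> M\<close>, \<open>M \<otimes> A\<close> and
  \<open>M \<otimes> M\<close>. The (co)associativity of the direct sum is a restatement of the hypotheses on \<open>M\<close>.
  The blocks of the remaining axioms of \<open>A \<oplus> M\<close>, evaluated on \<open>a + m\<close> and \<open>b + n\<close>, are sums of
  terms that depend only on \<open>(a, b)\<close>, \<open>(a, n)\<close>, \<open>(m, b)\<close> or \<open>(m, n)\<close>; setting two of the four
  elements to zero separates them into the conditions on the Hopf bimodule, the bimodule
  coalgebra, the bicomodule algebra, and the last compatibility condition (the \<open>M \<otimes> M\<close> block of
  the pair \<open>(m, n)\<close>).
\<close>

section \<open>Calculus of \<open>tensor_space\<close> and \<open>tensor_map\<close>\<close>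

lemma linear_map_zero:
  assumes "Vector_Spaces.linear s1 s2 f"
  shows "f 0 = 0"
proof -
  have "f (0 + 0) = f 0 + f 0"
    using assms unfolding linear_field_iff by blast
  then show ?thesis by simp
qed

text \<open>Every generator vanishes at such an \<open>F\<close> by the normalisation in
  \<open>tensor\<close>, so evaluation at \<open>F\<close> agrees with the zero functional on the
  generators and hence on their span. Consequently equality of two tensors only has to be tested on
  bilinear forms.\<close>

lemma tensor_space_not_bilinear:
  assumes "t \<in> tensor_space s1 s2" "\<not> bilinear_map s1 s2 (*) F"
  shows "t F = 0"
proof (rule linear_functional_unique[OF linear_eval _ _ assms(1)[unfolded tensor_space_def]])
  show "Vector_Spaces.linear fscale (*) (\<lambda>_. 0)"
    by (simp add: linear_field_iff vector_space_mult vector_space_fscale)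
qed (use assms(2) in \<open>auto simp: tensor_def\<close>)

lemma tensor_space_subspace: "module.subspace fscale (tensor_space s1 s2)"
  unfolding tensor_space_def by (rule module.subspace_span[OF module_fscale])

lemmas tensor_space_add = module.subspace_add[OF module_fscale tensor_space_subspace]
  and tensor_space_fscale = module.subspace_scale[OF module_fscale tensor_space_subspace]

lemma tensor_in_tensor_space: "tensor s1 s2 x y \<in> tensor_space s1 s2"
  unfolding tensor_space_def by (rule module.span_base[OF module_fscale]) auto

lemma tensor_map_plus:
    "tensor_map s1 s2 f g (t + t') = tensor_map s1 s2 f g t + tensor_map s1 s2 f g t'"
  and tensor_map_scale: "tensor_map s1 s2 f g (fscale c t) = fscale c (tensor_map s1 s2 f g t)"
  and tensor_map_0: "tensor_map s1 s2 f g 0 = 0"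
  by (auto simp: tensor_map_def fscale_def fun_eq_iff)

text \<open>The elements that \<open>tensor_map\<close> sends into the target tensor space form a
  subspace; it contains all generators, since pure tensors go to pure tensors, and so it contains
  their span.\<close>

lemma tensor_map_in_tensor_space:
  assumes "t \<in> tensor_space s1 s2"
    and "Vector_Spaces.linear s1 s1' f" "Vector_Spaces.linear s2 s2' g"
  shows "tensor_map s1' s2' f g t \<in> tensor_space s1' s2'"
proof -
  have "module.subspace fscale {t. tensor_map s1' s2' f g t \<in> tensor_space s1' s2'}"
    using module.subspace_0[OF module_fscale tensor_space_subspace]
    by (auto simp: module.subspace_def[OF module_fscale] tensor_map_plus tensor_map_scale
        tensor_map_0 intro: tensor_space_add tensor_space_fscale)
  then have "tensor_space s1 s2 \<subseteq> {t. tensor_map s1' s2' f g t \<in> tensor_space s1' s2'}"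
    unfolding tensor_space_def[of s1 s2]
    by (intro module.span_minimal[OF module_fscale])
      (auto simp: tensor_map_tensor[OF assms(2,3)] tensor_in_tensor_space)
  with assms(1) show ?thesis by blast
qed

text \<open>Linearity of the outer maps \<open>f\<close> and \<open>g\<close> makes the pullback of
  a bilinear form bilinear, so the bilinearity test inside the inner \<open>tensor_map\<close>
  succeeds whenever the outer one does.\<close>

lemma tensor_map_compose:
  assumes "Vector_Spaces.linear s1 s1' f" "Vector_Spaces.linear s2 s2' g"
  shows "tensor_map s1' s2' f g (tensor_map s1 s2 f' g' t) =
    tensor_map s1' s2' (\<lambda>x. f (f' x)) (\<lambda>y. g (g' y)) t"
  using assms by (auto simp: tensor_map_def fun_eq_iff bilinear_map_def linear_field_iff)

text \<open>On bilinear forms both sides evaluate \<open>t\<close> at the same form. On other forms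
  the left side is 0 by definition and the right side is 0 because \<open>t\<close> lies in the
  tensor space.\<close>

lemma tensor_map_ident:
  assumes "t \<in> tensor_space s1 s2"
  shows "tensor_map s1 s2 (\<lambda>x. x) (\<lambda>y. y) t = t"
  using tensor_space_not_bilinear[OF assms] by (auto simp: tensor_map_def fun_eq_iff)

lemma bilinear_form_add:
  assumes "bilinear_map s1 s2 (*) F" "bilinear_map s1 s2 (*) G"
  shows "bilinear_map s1 s2 (*) (\<lambda>x y. F x y + G x y)"
  using assms by (simp add: bilinear_map_def linear_field_iff algebra_simps)

lemma bilinear_form_compose:
  assumes "bilinear_map s1' s2' (*) F"
    and "Vector_Spaces.linear s1 s1' f" "Vector_Spaces.linear s2 s2' g"
  shows "bilinear_map s1 s2 (*) (\<lambda>x y. F (f x) (g y))"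
  using assms by (auto simp: bilinear_map_def linear_field_iff)

text \<open>Bilinearity of \<open>F\<close> splits the pulled-back form into a sum of two bilinear
  forms, and a member of the tensor space is additive on such forms. This and
  \<open>tensor_map_add_right\<close> later distribute the \<open>M\<close>-component of a product
  over its three summands.\<close>

lemma tensor_map_add_left:
  assumes "t \<in> tensor_space s1 s2" "Vector_Spaces.linear s1 s1' f"
    "Vector_Spaces.linear s1 s1' f'" "Vector_Spaces.linear s2 s2' g"
  shows "tensor_map s1' s2' (\<lambda>x. f x + f' x) g t =
    tensor_map s1' s2' f g t + tensor_map s1' s2' f' g t"
proof (rule ext)
  fix F
  show "tensor_map s1' s2' (\<lambda>x. f x + f' x) g t F =
    (tensor_map s1' s2' f g t + tensor_map s1' s2' f' g t) F"
  proof (cases "bilinear_map s1' s2' (*) F")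
    case True
    then have "F (x + y) z = F x z + F y z" for x y z
      by (simp add: bilinear_map_def linear_field_iff)
    with True show ?thesis
      using tensor_space_form_linear(1)[OF assms(1) bilinear_form_compose[OF True assms(2,4)]
          bilinear_form_compose[OF True assms(3,4)]]
      by (simp add: tensor_map_def)
  qed (simp add: tensor_map_def)
qed

lemma tensor_map_add_right:
  assumes "t \<in> tensor_space s1 s2" "Vector_Spaces.linear s1 s1' f"
    "Vector_Spaces.linear s2 s2' g" "Vector_Spaces.linear s2 s2' g'"
  shows "tensor_map s1' s2' f (\<lambda>y. g y + g' y) t =
    tensor_map s1' s2' f g t + tensor_map s1' s2' f g' t"
proof (rule ext)
  fix F
  show "tensor_map s1' s2' f (\<lambda>y. g y + g' y) t F =
    (tensor_map s1' s2' f g t + tensor_map s1' s2' f g' t) F"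
  proof (cases "bilinear_map s1' s2' (*) F")
    case True
    then have "F z (x + y) = F z x + F z y" for x y z
      by (simp add: bilinear_map_def linear_field_iff)
    with True show ?thesis
      using tensor_space_form_linear(1)[OF assms(1) bilinear_form_compose[OF True assms(2,3)]
          bilinear_form_compose[OF True assms(2,4)]]
      by (simp add: tensor_map_def)
  qed (simp add: tensor_map_def)
qed

lemma bilinear_form_zero:
  assumes "bilinear_map s1 s2 (*) F"
  shows "F 0 y = 0" "F x 0 = 0"
proof -
  have "F (0 + 0) y = F 0 y + F 0 y" "F x (0 + 0) = F x 0 + F x 0"
    using assms unfolding bilinear_map_def linear_field_iff by blast+
  then show "F 0 y = 0" "F x 0 = 0" by (simp_all only: add_0_right add_cancel_right_right)
qed

lemma tensor_space_zero_form:
  assumes "t \<in> tensor_space s1 s2"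
  shows "t (\<lambda>x y. 0) = 0"
\<comment> \<open>The zero form counts as bilinear exactly when \<open>s1\<close> and
  \<open>s2\<close> satisfy the vector space axioms; if it does not, \<open>t\<close> vanishes there
  anyway.\<close>
proof (cases "bilinear_map s1 s2 (*) (\<lambda>x y. 0)")
  case True
  from tensor_space_form_linear(1)[OF assms True True] show ?thesis
    by (simp only: add_0_right add_cancel_right_right)
qed (use tensor_space_not_bilinear[OF assms] in blast)

text \<open>A bilinear form pulled back along a zero map is the zero form. With its mirror image
  \<open>tensor_map_zero_right\<close> this removes the summands that miss a given block.\<close>

lemma tensor_map_zero_left:
  assumes "t \<in> tensor_space s1 s2"
  shows "tensor_map s1' s2' (\<lambda>x. 0) g t = 0"
  using tensor_space_zero_form[OF assms]
  by (auto simp: tensor_map_def fun_eq_iff bilinear_form_zero)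

lemma tensor_map_zero_right:
  assumes "t \<in> tensor_space s1 s2"
  shows "tensor_map s1' s2' f (\<lambda>y. 0) t = 0"
  using tensor_space_zero_form[OF assms]
  by (auto simp: tensor_map_def fun_eq_iff bilinear_form_zero)

lemma tensor_zero:
  "tensor s1 s2 0 y = 0" "tensor s1 s2 x 0 = 0"
  by (auto simp: tensor_def fun_eq_iff bilinear_form_zero)

section \<open>Direct sums of vector spaces and the four blocks of a tensor\<close>

locale vector_space_sum =
  fixes sA :: "'k::field \<Rightarrow> 'a::ab_group_add \<Rightarrow> 'a"
    and sM :: "'k \<Rightarrow> 'm::ab_group_add \<Rightarrow> 'm"
  assumes vsA: "vector_space sA" and vsM: "vector_space sM"
begin

abbreviation "sP \<equiv> module_prod.scale sA sM"

lemma module_prod: "module_prod sA sM"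
  using vsA vsM by (simp add: module_prod_def module_pair_def module_iff_vector_space)

lemma sP_Pair: "sP c (a, m) = (sA c a, sM c m)"
  by (rule module_prod.scale_prod[OF module_prod])

lemma vsP: "vector_space sP"
proof -
  interpret A: vector_space sA by (rule vsA)
  interpret M: vector_space sM by (rule vsM)
  show ?thesis
    by unfold_locales (auto simp: sP_Pair A.scale_right_distrib A.scale_left_distrib
        M.scale_right_distrib M.scale_left_distrib)
qed

lemma linear_inl: "Vector_Spaces.linear sA sP (\<lambda>a. (a, 0))"
  and linear_inr: "Vector_Spaces.linear sM sP (\<lambda>m. (0, m))"
  and linear_fst: "Vector_Spaces.linear sP sA fst"
  and linear_snd: "Vector_Spaces.linear sP sM snd"
  using module.scale_zero_right[of sA] module.scale_zero_right[of sM]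
  by (simp_all add: linear_field_iff sP_Pair module_iff_vector_space vsA vsM vsP)

lemma linear_map_prod:
  assumes "Vector_Spaces.linear sA sA f" "Vector_Spaces.linear sM sM g"
  shows "Vector_Spaces.linear sP sP (map_prod f g)"
  using assms by (simp add: linear_field_iff sP_Pair vsP)

text \<open>Both arguments are written as \<open>(fst x, 0) + (0, snd x)\<close>; bilinearity of
  \<open>F\<close> yields four bilinear forms, and \<open>t\<close> is additive on bilinear
  forms.\<close>

lemma tensor_form_blocks:
  assumes t: "t \<in> tensor_space sP sP" and F: "bilinear_map sP sP (*) F"
  shows "t F = t (\<lambda>x y. F (fst x, 0) (fst y, 0)) + t (\<lambda>x y. F (fst x, 0) (0, snd y)) +
    t (\<lambda>x y. F (0, snd x) (fst y, 0)) + t (\<lambda>x y. F (0, snd x) (0, snd y))"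
proof -
  have lin: "Vector_Spaces.linear sP sP (\<lambda>x. (fst x, 0))"
    "Vector_Spaces.linear sP sP (\<lambda>x. (0, snd x))"
    using linear_inl linear_inr linear_fst linear_snd by (auto simp: linear_field_iff)
  have bil: "bilinear_map sP sP (*) (\<lambda>x y. F (fst x, 0) (fst y, 0))"
    "bilinear_map sP sP (*) (\<lambda>x y. F (fst x, 0) (0, snd y))"
    "bilinear_map sP sP (*) (\<lambda>x y. F (0, snd x) (fst y, 0))"
    "bilinear_map sP sP (*) (\<lambda>x y. F (0, snd x) (0, snd y))"
    using bilinear_form_compose[OF F lin(1) lin(1)] bilinear_form_compose[OF F lin(1) lin(2)]
      bilinear_form_compose[OF F lin(2) lin(1)] bilinear_form_compose[OF F lin(2) lin(2)] by auto
  \<comment> \<open>Quantifiers over pairs are kept whole, so that the additivity laws apply to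
    \<open>u\<close>, \<open>v\<close>, \<open>w\<close> as elements of the sum.\<close>
  have F2: "F (u + v) w = F u w + F v w" "F w (u + v) = F w u + F w v" for u v w
    using F by (simp_all add: bilinear_map_def linear_field_iff del: split_paired_All)
  have "F x y = F (fst x, 0) (fst y, 0) + F (fst x, 0) (0, snd y) +
    F (0, snd x) (fst y, 0) + F (0, snd x) (0, snd y)" for x y
    using F2(1)[of "(fst x, 0)" "(0, snd x)" y] F2(2)[of "(fst x, 0)" "(fst y, 0)" "(0, snd y)"]
      F2(2)[of "(0, snd x)" "(fst y, 0)" "(0, snd y)"] by simp
  then have "t F = t (\<lambda>x y. F (fst x, 0) (fst y, 0) + F (fst x, 0) (0, snd y) +
    F (0, snd x) (fst y, 0) + F (0, snd x) (0, snd y))"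
    by metis
  also have "\<dots> = t (\<lambda>x y. F (fst x, 0) (fst y, 0)) + t (\<lambda>x y. F (fst x, 0) (0, snd y)) +
    t (\<lambda>x y. F (0, snd x) (fst y, 0)) + t (\<lambda>x y. F (0, snd x) (0, snd y))"
    using tensor_space_form_linear(1)[OF t] bil by (simp add: bilinear_form_add)
  finally show ?thesis .
qed

text \<open>On a bilinear form a tensor is the sum of its four projected blocks, each evaluated at
  the form restricted along the inclusions. On all other forms both tensors vanish.\<close>

lemma tensor_eq_iff_blocks:
  assumes t: "t \<in> tensor_space sP sP" and t': "t' \<in> tensor_space sP sP"
  shows "t = t' \<longleftrightarrow>
    tensor_map sA sA fst fst t = tensor_map sA sA fst fst t' \<and>
    tensor_map sA sM fst snd t = tensor_map sA sM fst snd t' \<and>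
    tensor_map sM sA snd fst t = tensor_map sM sA snd fst t' \<and>
    tensor_map sM sM snd snd t = tensor_map sM sM snd snd t'" (is "_ \<longleftrightarrow> ?B")
proof
  assume B: ?B
  have blocks: "u F = tensor_map sA sA fst fst u (\<lambda>x y. F (x, 0) (y, 0)) +
      tensor_map sA sM fst snd u (\<lambda>x y. F (x, 0) (0, y)) +
      tensor_map sM sA snd fst u (\<lambda>x y. F (0, x) (y, 0)) +
      tensor_map sM sM snd snd u (\<lambda>x y. F (0, x) (0, y))"
    if u: "u \<in> tensor_space sP sP" and F: "bilinear_map sP sP (*) F" for u F
    unfolding tensor_form_blocks[OF u F]
    using bilinear_form_compose[OF F linear_inl linear_inl]
      bilinear_form_compose[OF F linear_inl linear_inr]
      bilinear_form_compose[OF F linear_inr linear_inl]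
      bilinear_form_compose[OF F linear_inr linear_inr]
    by (simp add: tensor_map_def)
  show "t = t'"
  proof (rule ext)
    fix F
    show "t F = t' F"
    proof (cases "bilinear_map sP sP (*) F")
      case True
      then show ?thesis using blocks[OF t] blocks[OF t'] B by simp
    qed (simp add: tensor_space_not_bilinear[OF t] tensor_space_not_bilinear[OF t'])
  qed
qed simp

end

section \<open>The comultiplication on the direct sum\<close>

text \<open>Only linearity of the four structure maps is built in; the coalgebra and comodule axioms
  enter as hypotheses of single lemmas or as one side of an equivalence.\<close>

locale sum_coalgebra = vector_space_sum sA sM
  for sA :: "'k::field \<Rightarrow> 'a::ab_group_add \<Rightarrow> 'a" and sM :: "'k \<Rightarrow> 'm::ab_group_add \<Rightarrow> 'm" +
  fixes \<Delta> :: "'a \<Rightarrow> ('a, 'a, 'k) tensor" and \<Delta>M :: "'m \<Rightarrow> ('m, 'm, 'k) tensor"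
    and \<rho> :: "'m \<Rightarrow> ('a, 'm, 'k) tensor" and \<phi> :: "'m \<Rightarrow> ('m, 'a, 'k) tensor"
  assumes \<Delta>: "linear_to_tensor sA sA sA \<Delta>" and \<Delta>M: "linear_to_tensor sM sM sM \<Delta>M"
    and \<rho>: "linear_to_tensor sM sA sM \<rho>" and \<phi>: "linear_to_tensor sM sM sA \<phi>"
begin

abbreviation "\<Delta>P \<equiv> sum_comult sA sM \<Delta> \<Delta>M \<rho> \<phi>"

lemma in_spaces:
  "\<Delta> a \<in> tensor_space sA sA" "\<Delta>M m \<in> tensor_space sM sM"
  "\<rho> m \<in> tensor_space sA sM" "\<phi> m \<in> tensor_space sM sA"
  using \<Delta> \<Delta>M \<rho> \<phi> by (auto simp: linear_to_tensor_def)

lemma comult_add: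
  "\<Delta> (a + b) = \<Delta> a + \<Delta> b" "\<Delta>M (m + n) = \<Delta>M m + \<Delta>M n"
  "\<rho> (m + n) = \<rho> m + \<rho> n" "\<phi> (m + n) = \<phi> m + \<phi> n"
  using \<Delta> \<Delta>M \<rho> \<phi> by (auto simp: linear_to_tensor_def linear_field_iff)

lemma comult_zero: "\<Delta> 0 = 0" "\<Delta>M 0 = 0" "\<rho> 0 = 0" "\<phi> 0 = 0"
  using comult_add(1)[of 0 0] comult_add(2)[of 0 0] comult_add(3)[of 0 0] comult_add(4)[of 0 0]
  by simp_all

lemma sum_comult_Pair:
  "\<Delta>P (a, m) = tensor_map sP sP (\<lambda>a. (a, 0)) (\<lambda>a. (a, 0)) (\<Delta> a) +
    tensor_map sP sP (\<lambda>a. (a, 0)) (\<lambda>m. (0, m)) (\<rho> m) +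
    tensor_map sP sP (\<lambda>m. (0, m)) (\<lambda>a. (a, 0)) (\<phi> m) +
    tensor_map sP sP (\<lambda>m. (0, m)) (\<lambda>m. (0, m)) (\<Delta>M m)"
  by (simp add: sum_comult_def Let_def)

text \<open>Each summand of \<open>\<Delta>P\<close> is already the image of a component under two
  inclusions, so \<open>f\<close> and \<open>g\<close> are composed with these. All block
  computations below start from this expansion.\<close>

lemma tensor_map_sum_comult:
  assumes "Vector_Spaces.linear sP s1 f" "Vector_Spaces.linear sP s2 g"
  shows "tensor_map s1 s2 f g (\<Delta>P (a, m)) =
    tensor_map s1 s2 (\<lambda>a. f (a, 0)) (\<lambda>a. g (a, 0)) (\<Delta> a) +
    tensor_map s1 s2 (\<lambda>a. f (a, 0)) (\<lambda>m. g (0, m)) (\<rho> m) +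
    tensor_map s1 s2 (\<lambda>m. f (0, m)) (\<lambda>a. g (a, 0)) (\<phi> m) +
    tensor_map s1 s2 (\<lambda>m. f (0, m)) (\<lambda>m. g (0, m)) (\<Delta>M m)"
  using assms by (simp add: sum_comult_Pair tensor_map_plus tensor_map_compose)

lemma sum_comult_form:
  assumes "bilinear_map sP sP (*) F"
  shows "\<Delta>P (a, m) F = \<Delta> a (\<lambda>x y. F (x, 0) (y, 0)) + \<rho> m (\<lambda>x y. F (x, 0) (0, y)) +
    \<phi> m (\<lambda>x y. F (0, x) (y, 0)) + \<Delta>M m (\<lambda>x y. F (0, x) (0, y))"
  using assms by (simp add: sum_comult_Pair tensor_map_def)

lemmas zero_maps = in_spaces[THEN tensor_map_zero_left] in_spaces[THEN tensor_map_zero_right]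

text \<open>A projection after an inclusion is the identity or zero, so exactly one of the four
  summands survives in each block.\<close>

lemma sum_comult_blocks:
  "tensor_map sA sA fst fst (\<Delta>P (a, m)) = \<Delta> a"
  "tensor_map sA sM fst snd (\<Delta>P (a, m)) = \<rho> m"
  "tensor_map sM sA snd fst (\<Delta>P (a, m)) = \<phi> m"
  "tensor_map sM sM snd snd (\<Delta>P (a, m)) = \<Delta>M m"
  by (simp_all add: tensor_map_sum_comult linear_fst linear_snd in_spaces
      tensor_map_ident zero_maps)

lemma sum_comult_in_space: "\<Delta>P x \<in> tensor_space sP sP"
  by (cases x) (simp add: sum_comult_Pair tensor_space_add in_spaces
      tensor_map_in_tensor_space[OF _ linear_inl linear_inl]
      tensor_map_in_tensor_space[OF _ linear_inl linear_inr]
      tensor_map_in_tensor_space[OF _ linear_inr linear_inl]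
      tensor_map_in_tensor_space[OF _ linear_inr linear_inr])

lemma linear_sum_comult: "linear_to_tensor sP sP sP \<Delta>P"
proof -
  have "\<Delta> (sA c a) = fscale c (\<Delta> a)" "\<Delta>M (sM c m) = fscale c (\<Delta>M m)"
    "\<rho> (sM c m) = fscale c (\<rho> m)" "\<phi> (sM c m) = fscale c (\<phi> m)" for c a m
    using \<Delta> \<Delta>M \<rho> \<phi> by (auto simp: linear_to_tensor_def linear_field_iff)
  then show ?thesis
    using sum_comult_in_space
    by (auto simp: linear_to_tensor_def linear_field_iff vsP vector_space_fscale sP_Pair
        sum_comult_Pair comult_add tensor_map_plus tensor_map_scale
        module.scale_right_distrib[OF module_fscale])
qed

text \<open>\<open>map_prod f g\<close> preserves the two summands because \<open>f 0 = 0\<close>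
  and \<open>g 0 = 0\<close>. The condition therefore splits blockwise into one equation for each of
  \<open>\<Delta>\<close>, \<open>\<rho>\<close>, \<open>\<phi>\<close>,
  \<open>\<Delta>M\<close>.\<close>

lemma comultiplicative_sum_iff:
  assumes "Vector_Spaces.linear sA sA f" "Vector_Spaces.linear sM sM g"
  shows "comultiplicative sP \<Delta>P (map_prod f g) \<longleftrightarrow>
    comultiplicative sA \<Delta> f \<and> comultiplicative sM \<Delta>M g \<and>
    (\<forall>m. tensor_map sA sM f g (\<rho> m) = \<rho> (g m)) \<and>
    (\<forall>m. tensor_map sM sA g f (\<phi> m) = \<phi> (g m))"
proof -
  have f0: "f 0 = 0" and g0: "g 0 = 0"
    using assms by (simp_all add: linear_map_zero)
  note fg = linear_map_prod[OF assms]
  have "tensor_map sP sP (map_prod f g) (map_prod f g) (\<Delta>P (a, m)) = \<Delta>P (map_prod f g (a, m)) \<longleftrightarrow>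
    tensor_map sA sA f f (\<Delta> a) = \<Delta> (f a) \<and> tensor_map sA sM f g (\<rho> m) = \<rho> (g m) \<and>
    tensor_map sM sA g f (\<phi> m) = \<phi> (g m) \<and> tensor_map sM sM g g (\<Delta>M m) = \<Delta>M (g m)" for a m
    by (subst tensor_eq_iff_blocks[OF
          tensor_map_in_tensor_space[OF sum_comult_in_space fg fg] sum_comult_in_space])
      (simp_all add: sum_comult_blocks tensor_map_sum_comult[OF fg fg] tensor_map_plus
        tensor_map_compose
        linear_fst linear_snd f0 g0 zero_maps)
  then show ?thesis
    by (auto simp: comultiplicative_def)
qed

text \<open>Evaluated at a trilinear form on the sum, both iterated comultiplications split into
  eight terms, one for each choice of \<open>A\<close> or \<open>M\<close> in the three tensor
  factors. Each pair of terms agrees by one of the hypotheses. At other forms both sides are 0 by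
  definition.\<close>

lemma sum_coassociative:
  assumes "bihom_bicomodule_coalgebra sA \<Delta> \<psi>A \<omega>A sM \<Delta>M \<rho> \<phi> \<psi>M \<omega>M"
  shows "bihom_coassociative sP \<Delta>P (map_prod \<psi>A \<psi>M) (map_prod \<omega>A \<omega>M)"
proof -
  have lin: "Vector_Spaces.linear sA sA \<psi>A" "Vector_Spaces.linear sA sA \<omega>A"
    "Vector_Spaces.linear sM sM \<psi>M" "Vector_Spaces.linear sM sM \<omega>M"
    and co: "\<psi>A \<circ> \<omega>A = \<omega>A \<circ> \<psi>A" "\<psi>M \<circ> \<omega>M = \<omega>M \<circ> \<psi>M"
    using assms unfolding bihom_bicomodule_coalgebra_def bihom_bicomodule_def
        left_bihom_comodule_def bihom_coassociative_def by blast+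
  have comult: "comultiplicative sP \<Delta>P (map_prod \<psi>A \<psi>M)" "comultiplicative sP \<Delta>P (map_prod \<omega>A \<omega>M)"
    using assms
    unfolding comultiplicative_sum_iff[OF lin(1,3)] comultiplicative_sum_iff[OF lin(2,4)]
    unfolding bihom_bicomodule_coalgebra_def bihom_bicomodule_def
        left_bihom_comodule_def right_bihom_comodule_def bihom_coassociative_def by blast+
  have zero: "\<psi>A 0 = 0" "\<omega>A 0 = 0" "\<psi>M 0 = 0" "\<omega>M 0 = 0"
    using lin by (simp_all add: linear_map_zero)
  \<comment> \<open>In order, the target factors are AAA, AAM, MAA, AMA, AMM, MMA, MAM, MMM:
    coassociativity of \<open>A\<close>, the three bicomodule laws, the three bicomodule coalgebra
    laws, and coassociativity of \<open>M\<close>.\<close>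
  have coass:
    "tensor_map_left sA sA sA \<Delta> \<psi>A (\<Delta> a) = tensor_map_right sA sA sA \<omega>A \<Delta> (\<Delta> a)"
    "tensor_map_right sA sA sM \<omega>A \<rho> (\<rho> m) = tensor_map_left sA sA sM \<Delta> \<psi>M (\<rho> m)"
    "tensor_map_right sM sA sA \<omega>M \<Delta> (\<phi> m) = tensor_map_left sM sA sA \<phi> \<psi>A (\<phi> m)"
    "tensor_map_right sA sM sA \<omega>A \<phi> (\<rho> m) = tensor_map_left sA sM sA \<rho> \<psi>A (\<phi> m)"
    "tensor_map_right sA sM sM \<omega>A \<Delta>M (\<rho> m) = tensor_map_left sA sM sM \<rho> \<psi>M (\<Delta>M m)"
    "tensor_map_right sM sM sA \<omega>M \<phi> (\<Delta>M m) = tensor_map_left sM sM sA \<Delta>M \<psi>A (\<phi> m)"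
    "tensor_map_right sM sA sM \<omega>M \<rho> (\<Delta>M m) = tensor_map_left sM sA sM \<phi> \<psi>M (\<Delta>M m)"
    "tensor_map_left sM sM sM \<Delta>M \<psi>M (\<Delta>M m) = tensor_map_right sM sM sM \<omega>M \<Delta>M (\<Delta>M m)" for a m
    using assms unfolding bihom_bicomodule_coalgebra_def bihom_bicomodule_def
        left_bihom_comodule_def right_bihom_comodule_def bihom_coassociative_def by blast+
  have "tensor_map_left sP sP sP \<Delta>P (map_prod \<psi>A \<psi>M) (\<Delta>P (a, m)) F =
    tensor_map_right sP sP sP (map_prod \<omega>A \<omega>M) \<Delta>P (\<Delta>P (a, m)) F"
    if F: "trilinear_map sP sP sP (*) F" for a m F
  proof -
    have Fl: "bilinear_map sP sP (*) (\<lambda>u v. F u v z)" and Fr: "bilinear_map sP sP (*) (F z)" for z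
      using F unfolding trilinear_map_def by blast+
    \<comment> \<open>The form obtained after the inner comultiplication must be bilinear before the
      outer \<open>\<Delta>P\<close> can be expanded at it.\<close>
    note bl = bilinear_map_left_form[OF linear_sum_comult linear_map_prod[OF lin(1,3)] F]
      and br = bilinear_map_right_form[OF linear_map_prod[OF lin(2,4)] linear_sum_comult F]
    \<comment> \<open>Restriction of \<open>F\<close> along linear maps into the sum. The source
      types are arbitrary, so this one fact covers all eight mixtures of the inclusions of
      \<open>A\<close> and \<open>M\<close>.\<close>
    have tri: "trilinear_map s1 s2 s3 (*) (\<lambda>x y z. F (i x) (j y) (k z))"
      if "Vector_Spaces.linear s1 sP i" "Vector_Spaces.linear s2 sP j"
        "Vector_Spaces.linear s3 sP k"
      for i j k and s1 :: "'k \<Rightarrow> 'x::ab_group_add \<Rightarrow> 'x" and s2 :: "'k \<Rightarrow> 'y::ab_group_add \<Rightarrow> 'y"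
        and s3 :: "'k \<Rightarrow> 'z::ab_group_add \<Rightarrow> 'z"
      using bilinear_form_compose[OF Fl that(1,2)] bilinear_form_compose[OF Fr that(2,3)]
      by (simp add: trilinear_map_def)
    \<comment> \<open>Each of the next eight facts is one of the laws above, tested at the
      restriction of \<open>F\<close> to the summands named by its three letters.\<close>
    have AAA: "\<Delta> a (\<lambda>x y. \<Delta> x (\<lambda>u v. F (u, 0) (v, 0) (\<psi>A y, 0))) =
      \<Delta> a (\<lambda>x y. \<Delta> y (\<lambda>u v. F (\<omega>A x, 0) (u, 0) (v, 0)))"
      using fun_cong[OF coass(1)[of a], of "\<lambda>x y z. F (x, 0) (y, 0) (z, 0)"]
        tri[OF linear_inl linear_inl linear_inl]
      by (simp add: tensor_map_left_def tensor_map_right_def)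
    have AAM: "\<rho> m (\<lambda>x y. \<Delta> x (\<lambda>u v. F (u, 0) (v, 0) (0, \<psi>M y))) =
      \<rho> m (\<lambda>x y. \<rho> y (\<lambda>u v. F (\<omega>A x, 0) (u, 0) (0, v)))"
      using fun_cong[OF coass(2)[of m, symmetric], of "\<lambda>x y z. F (x, 0) (y, 0) (0, z)"]
        tri[OF linear_inl linear_inl linear_inr]
      by (simp add: tensor_map_left_def tensor_map_right_def)
    have MAA: "\<phi> m (\<lambda>x y. \<phi> x (\<lambda>u v. F (0, u) (v, 0) (\<psi>A y, 0))) =
      \<phi> m (\<lambda>x y. \<Delta> y (\<lambda>u v. F (0, \<omega>M x) (u, 0) (v, 0)))"
      using fun_cong[OF coass(3)[of m, symmetric], of "\<lambda>x y z. F (0, x) (y, 0) (z, 0)"]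
        tri[OF linear_inr linear_inl linear_inl]
      by (simp add: tensor_map_left_def tensor_map_right_def)
    have AMA: "\<phi> m (\<lambda>x y. \<rho> x (\<lambda>u v. F (u, 0) (0, v) (\<psi>A y, 0))) =
      \<rho> m (\<lambda>x y. \<phi> y (\<lambda>u v. F (\<omega>A x, 0) (0, u) (v, 0)))"
      using fun_cong[OF coass(4)[of m, symmetric], of "\<lambda>x y z. F (x, 0) (0, y) (z, 0)"]
        tri[OF linear_inl linear_inr linear_inl]
      by (simp add: tensor_map_left_def tensor_map_right_def)
    have AMM: "\<Delta>M m (\<lambda>x y. \<rho> x (\<lambda>u v. F (u, 0) (0, v) (0, \<psi>M y))) =
      \<rho> m (\<lambda>x y. \<Delta>M y (\<lambda>u v. F (\<omega>A x, 0) (0, u) (0, v)))"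
      using fun_cong[OF coass(5)[of m, symmetric], of "\<lambda>x y z. F (x, 0) (0, y) (0, z)"]
        tri[OF linear_inl linear_inr linear_inr]
      by (simp add: tensor_map_left_def tensor_map_right_def)
    have MMA: "\<phi> m (\<lambda>x y. \<Delta>M x (\<lambda>u v. F (0, u) (0, v) (\<psi>A y, 0))) =
      \<Delta>M m (\<lambda>x y. \<phi> y (\<lambda>u v. F (0, \<omega>M x) (0, u) (v, 0)))"
      using fun_cong[OF coass(6)[of m, symmetric], of "\<lambda>x y z. F (0, x) (0, y) (z, 0)"]
        tri[OF linear_inr linear_inr linear_inl]
      by (simp add: tensor_map_left_def tensor_map_right_def)
    have MAM: "\<Delta>M m (\<lambda>x y. \<phi> x (\<lambda>u v. F (0, u) (v, 0) (0, \<psi>M y))) =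
      \<Delta>M m (\<lambda>x y. \<rho> y (\<lambda>u v. F (0, \<omega>M x) (u, 0) (0, v)))"
      using fun_cong[OF coass(7)[of m, symmetric], of "\<lambda>x y z. F (0, x) (y, 0) (0, z)"]
        tri[OF linear_inr linear_inl linear_inr]
      by (simp add: tensor_map_left_def tensor_map_right_def)
    have MMM: "\<Delta>M m (\<lambda>x y. \<Delta>M x (\<lambda>u v. F (0, u) (0, v) (0, \<psi>M y))) =
      \<Delta>M m (\<lambda>x y. \<Delta>M y (\<lambda>u v. F (0, \<omega>M x) (0, u) (0, v)))"
      using fun_cong[OF coass(8)[of m], of "\<lambda>x y z. F (0, x) (0, y) (0, z)"]
        tri[OF linear_inr linear_inr linear_inr]
      by (simp add: tensor_map_left_def tensor_map_right_def)
    \<comment> \<open>Bilinearity of the sixteen inner forms, eight for each bracketing; it permits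
      the outer comultiplications to be distributed over sums of these forms.\<close>
    note bil =
      bilinear_map_left_form[OF \<Delta> lin(1) tri[OF linear_inl linear_inl linear_inl]]
      bilinear_map_left_form[OF \<Delta> lin(3) tri[OF linear_inl linear_inl linear_inr]]
      bilinear_map_left_form[OF \<phi> lin(1) tri[OF linear_inr linear_inl linear_inl]]
      bilinear_map_left_form[OF \<rho> lin(1) tri[OF linear_inl linear_inr linear_inl]]
      bilinear_map_left_form[OF \<rho> lin(3) tri[OF linear_inl linear_inr linear_inr]]
      bilinear_map_left_form[OF \<Delta>M lin(1) tri[OF linear_inr linear_inr linear_inl]]
      bilinear_map_left_form[OF \<phi> lin(3) tri[OF linear_inr linear_inl linear_inr]]
      bilinear_map_left_form[OF \<Delta>M lin(3) tri[OF linear_inr linear_inr linear_inr]]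
      bilinear_map_right_form[OF lin(2) \<Delta> tri[OF linear_inl linear_inl linear_inl]]
      bilinear_map_right_form[OF lin(2) \<rho> tri[OF linear_inl linear_inl linear_inr]]
      bilinear_map_right_form[OF lin(4) \<Delta> tri[OF linear_inr linear_inl linear_inl]]
      bilinear_map_right_form[OF lin(2) \<phi> tri[OF linear_inl linear_inr linear_inl]]
      bilinear_map_right_form[OF lin(2) \<Delta>M tri[OF linear_inl linear_inr linear_inr]]
      bilinear_map_right_form[OF lin(4) \<phi> tri[OF linear_inr linear_inr linear_inl]]
      bilinear_map_right_form[OF lin(4) \<rho> tri[OF linear_inr linear_inl linear_inr]]
      bilinear_map_right_form[OF lin(4) \<Delta>M tri[OF linear_inr linear_inr linear_inr]]
    show ?thesis
      using F bl br
      by (simp add: tensor_map_left_def tensor_map_right_def sum_comult_form Fl Fr zero comult_zero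
          tensor_space_form_linear(1)[OF in_spaces(1)] tensor_space_form_linear(1)[OF in_spaces(2)]
          tensor_space_form_linear(1)[OF in_spaces(3)] tensor_space_form_linear(1)[OF in_spaces(4)]
          bil bilinear_form_add AAA AAM MAA AMA AMM MMA MAM MMM)
  qed
  then have "tensor_map_left sP sP sP \<Delta>P (map_prod \<psi>A \<psi>M) (\<Delta>P x) =
    tensor_map_right sP sP sP (map_prod \<omega>A \<omega>M) \<Delta>P (\<Delta>P x)" for x
    by (cases x) (auto simp: tensor_map_left_def tensor_map_right_def fun_eq_iff)
  moreover have "map_prod \<psi>A \<psi>M \<circ> map_prod \<omega>A \<omega>M = map_prod \<omega>A \<omega>M \<circ> map_prod \<psi>A \<psi>M"
    unfolding map_prod_compose[symmetric] co ..
  ultimately show ?thesis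
    using lin comult linear_sum_comult
    by (simp add: bihom_coassociative_def linear_map_prod)
qed

end

section \<open>The multiplication on the direct sum\<close>

lemma bilinear_mapD:
  assumes "bilinear_map s1 s2 s f"
  shows "Vector_Spaces.linear s2 s (f x)" "Vector_Spaces.linear s1 s (\<lambda>x. f x y)"
    "f (x + x') y = f x y + f x' y" "f x (y + y') = f x y + f x y'"
    "f (s1 c x) y = s c (f x y)" "f x (s2 c y) = s c (f x y)" "f 0 y = 0" "f x 0 = 0"
  using assms linear_map_zero[of s2 s "f x"] linear_map_zero[of s1 s "\<lambda>x. f x y"]
  by (auto simp: bilinear_map_def linear_field_iff)

locale sum_algebra = vector_space_sum sA sM
  for sA :: "'k::field \<Rightarrow> 'a::ab_group_add \<Rightarrow> 'a" and sM :: "'k \<Rightarrow> 'm::ab_group_add \<Rightarrow> 'm" +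
  fixes \<mu> :: "'a \<Rightarrow> 'a \<Rightarrow> 'a" and \<mu>M :: "'m \<Rightarrow> 'm \<Rightarrow> 'm"
    and L :: "'a \<Rightarrow> 'm \<Rightarrow> 'm" and R :: "'m \<Rightarrow> 'a \<Rightarrow> 'm"
  assumes \<mu>: "bilinear_map sA sA sA \<mu>" and \<mu>M: "bilinear_map sM sM sM \<mu>M"
    and L: "bilinear_map sA sM sM L" and R: "bilinear_map sM sA sM R"
begin

abbreviation "\<mu>P \<equiv> sum_mult \<mu> \<mu>M L R"

lemma sum_mult_Pair: "\<mu>P (a, m) (b, n) = (\<mu> a b, L a n + R m b + \<mu>M m n)"
  by (simp add: sum_mult_def)

lemmas mult_linear = bilinear_mapD(1,2)[OF \<mu>] bilinear_mapD(1,2)[OF \<mu>M]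
    bilinear_mapD(1,2)[OF L] bilinear_mapD(1,2)[OF R]
  and mult_add = bilinear_mapD(3,4)[OF \<mu>] bilinear_mapD(3,4)[OF \<mu>M]
    bilinear_mapD(3,4)[OF L] bilinear_mapD(3,4)[OF R]
  and mult_scale = bilinear_mapD(5,6)[OF \<mu>] bilinear_mapD(5,6)[OF \<mu>M]
    bilinear_mapD(5,6)[OF L] bilinear_mapD(5,6)[OF R]
  and mult_zero = bilinear_mapD(7,8)[OF \<mu>] bilinear_mapD(7,8)[OF \<mu>M]
    bilinear_mapD(7,8)[OF L] bilinear_mapD(7,8)[OF R]

lemma bilinear_sum_mult: "bilinear_map sP sP sP \<mu>P"
proof -
  interpret M: vector_space sM by (rule vsM)
  show ?thesis
    by (simp add: bilinear_map_def linear_field_iff vsP sP_Pair sum_mult_Pair mult_add mult_scale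
        M.scale_right_distrib)
qed

text \<open>The \<open>M\<close>-component of a product is a sum of three bilinear terms in
  \<open>(a, n)\<close>, \<open>(m, b)\<close> and \<open>(m, n)\<close>. Setting two of the four
  elements to zero isolates each term; conversely linearity of \<open>g\<close> adds the three
  conditions up.\<close>

lemma multiplicative_sum_iff:
  assumes "Vector_Spaces.linear sA sA f" "Vector_Spaces.linear sM sM g"
  shows "multiplicative \<mu>P (map_prod f g) \<longleftrightarrow>
    multiplicative \<mu> f \<and> multiplicative \<mu>M g \<and>
    (\<forall>a m. g (L a m) = L (f a) (g m)) \<and> (\<forall>m a. g (R m a) = R (g m) (f a))"
    (is "?P \<longleftrightarrow> ?Q")
proof
  have zero: "f 0 = 0" "g 0 = 0"
    using assms by (simp_all add: linear_map_zero)
  assume ?P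
  then have P: "f (\<mu> a b) = \<mu> (f a) (f b)"
    "g (L a n + R m b + \<mu>M m n) = L (f a) (g n) + R (g m) (f b) + \<mu>M (g m) (g n)" for a b m n
    by (simp_all add: multiplicative_def sum_mult_Pair)
  show ?Q
    \<comment> \<open>The positions stand for \<open>a\<close>, \<open>n\<close>, \<open>m\<close>,
      \<open>b\<close>, in order of occurrence. The three choices leave the \<open>\<mu>M\<close>,
      \<open>L\<close> and \<open>R\<close> terms respectively.\<close>
    using P(1) P(2)[of 0 _ _ 0] P(2)[of _ _ 0 0] P(2)[of 0 0 _ _]
    by (simp add: multiplicative_def mult_zero zero)
next
  assume ?Q
  then show ?P
    using assms by (simp add: multiplicative_def sum_mult_Pair linear_field_iff)
qed

text \<open>Both bracketings of a triple product expand by additivity into eight terms, which match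
  one by one: this is the algebra counterpart of \<open>sum_coassociative\<close>.\<close>

lemma sum_associative:
  assumes "bihom_bimodule_algebra sA \<mu> \<alpha>A \<beta>A sM \<mu>M L R \<alpha>M \<beta>M"
  shows "bihom_associative sP \<mu>P (map_prod \<alpha>A \<alpha>M) (map_prod \<beta>A \<beta>M)"
proof -
  have lin: "Vector_Spaces.linear sA sA \<alpha>A" "Vector_Spaces.linear sA sA \<beta>A"
    "Vector_Spaces.linear sM sM \<alpha>M" "Vector_Spaces.linear sM sM \<beta>M"
    and co: "\<alpha>A \<circ> \<beta>A = \<beta>A \<circ> \<alpha>A" "\<alpha>M \<circ> \<beta>M = \<beta>M \<circ> \<alpha>M"
    using assms unfolding bihom_bimodule_algebra_def bihom_bimodule_def
      left_bihom_module_def bihom_associative_def by blast+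
  have "multiplicative \<mu>P (map_prod \<alpha>A \<alpha>M)" "multiplicative \<mu>P (map_prod \<beta>A \<beta>M)"
    using assms unfolding multiplicative_sum_iff[OF lin(1,3)] multiplicative_sum_iff[OF lin(2,4)]
    unfolding bihom_bimodule_algebra_def bihom_bimodule_def
      left_bihom_module_def right_bihom_module_def bihom_associative_def
    by - (elim conjE; intro conjI; assumption)+
  moreover have "map_prod \<alpha>A \<alpha>M \<circ> map_prod \<beta>A \<beta>M = map_prod \<beta>A \<beta>M \<circ> map_prod \<alpha>A \<alpha>M"
    unfolding map_prod_compose[symmetric] co ..
  \<comment> \<open>One identity for each way of taking the three factors from \<open>A\<close> or
    \<open>M\<close>, in the order AAA, AAM, MAA, AMA, MMM, AMM, MMA, MAM.\<close>
  moreover have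
    "\<forall>a b c. \<mu> (\<alpha>A a) (\<mu> b c) = \<mu> (\<mu> a b) (\<beta>A c)"
    "\<forall>a b p. L (\<alpha>A a) (L b p) = L (\<mu> a b) (\<beta>M p)"
    "\<forall>m b c. R (\<alpha>M m) (\<mu> b c) = R (R m b) (\<beta>A c)"
    "\<forall>a n c. L (\<alpha>A a) (R n c) = R (L a n) (\<beta>A c)"
    "\<forall>m n p. \<mu>M (\<alpha>M m) (\<mu>M n p) = \<mu>M (\<mu>M m n) (\<beta>M p)"
    "\<forall>a n p. L (\<alpha>A a) (\<mu>M n p) = \<mu>M (L a n) (\<beta>M p)"
    "\<forall>m n c. \<mu>M (\<alpha>M m) (R n c) = R (\<mu>M m n) (\<beta>A c)"
    "\<forall>m b p. \<mu>M (\<alpha>M m) (L b p) = \<mu>M (R m b) (\<beta>M p)"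
    using assms unfolding bihom_bimodule_algebra_def bihom_bimodule_def
      left_bihom_module_def right_bihom_module_def bihom_associative_def
    by - (elim conjE; assumption)+
  then have "\<mu>P (map_prod \<alpha>A \<alpha>M x) (\<mu>P y z) = \<mu>P (\<mu>P x y) (map_prod \<beta>A \<beta>M z)" for x y z
    by (cases x; cases y; cases z) (simp add: sum_mult_Pair mult_add)
  ultimately show ?thesis
    using lin bilinear_sum_mult by (simp add: bihom_associative_def linear_map_prod)
qed

end

section \<open>Compatibility of multiplication and comultiplication\<close>

text \<open>The compatibility axioms stay outside the locale, so that it is available in both
  directions of the final equivalence.\<close>

locale sum_bialgebra = sum_coalgebra sA sM \<Delta> \<Delta>M \<rho> \<phi> + sum_algebra sA sM \<mu> \<mu>M L R
  for sA :: "'k::field \<Rightarrow> 'a::ab_group_add \<Rightarrow> 'a" and sM :: "'k \<Rightarrow> 'm::ab_group_add \<Rightarrow> 'm"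
    and \<Delta> :: "'a \<Rightarrow> ('a, 'a, 'k) tensor" and \<Delta>M :: "'m \<Rightarrow> ('m, 'm, 'k) tensor"
    and \<rho> :: "'m \<Rightarrow> ('a, 'm, 'k) tensor" and \<phi> :: "'m \<Rightarrow> ('m, 'a, 'k) tensor"
    and \<mu> :: "'a \<Rightarrow> 'a \<Rightarrow> 'a" and \<mu>M :: "'m \<Rightarrow> 'm \<Rightarrow> 'm"
    and L :: "'a \<Rightarrow> 'm \<Rightarrow> 'm" and R :: "'m \<Rightarrow> 'a \<Rightarrow> 'm" +
  fixes l :: 'k and \<alpha>A \<beta>A \<psi>A \<omega>A :: "'a \<Rightarrow> 'a" and \<alpha>M \<beta>M \<psi>M \<omega>M :: "'m \<Rightarrow> 'm"
  assumes linA: "Vector_Spaces.linear sA sA \<alpha>A" "Vector_Spaces.linear sA sA \<beta>A"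
      "Vector_Spaces.linear sA sA \<psi>A" "Vector_Spaces.linear sA sA \<omega>A"
    and linM: "Vector_Spaces.linear sM sM \<alpha>M" "Vector_Spaces.linear sM sM \<beta>M"
      "Vector_Spaces.linear sM sM \<psi>M" "Vector_Spaces.linear sM sM \<omega>M"
begin

abbreviation "\<alpha>P \<equiv> map_prod \<alpha>A \<alpha>M"
abbreviation "\<beta>P \<equiv> map_prod \<beta>A \<beta>M"
abbreviation "\<psi>P \<equiv> map_prod \<psi>A \<psi>M"
abbreviation "\<omega>P \<equiv> map_prod \<omega>A \<omega>M"

lemmas structure_zero = linA[THEN linear_map_zero] linM[THEN linear_map_zero]

lemmas linP = linear_map_prod[OF linA(1) linM(1)] linear_map_prod[OF linA(2) linM(2)]
  bilinear_mapD(1,2)[OF bilinear_sum_mult]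

text \<open>Composing a product with an inclusion and a projection leaves only the products landing
  in the chosen summand. The \<open>A\<close>-component involves \<open>\<mu>\<close> alone, while
  the \<open>M\<close>-component is distributed over \<open>L\<close>, \<open>R\<close> and
  \<open>\<mu>M\<close>.\<close>

lemma compatible_iff_blocks:
  "\<Delta>P (\<mu>P (a, m) (b, n)) =
      tensor_map sP sP (\<lambda>y1. \<mu>P (\<omega>P (a, m)) y1) \<beta>P (\<Delta>P (b, n)) +
      tensor_map sP sP \<alpha>P (\<lambda>x2. \<mu>P x2 (\<psi>P (b, n))) (\<Delta>P (a, m)) +
      fscale l (tensor sP sP (\<alpha>P (\<omega>P (a, m))) (\<beta>P (\<psi>P (b, n)))) \<longleftrightarrow>
   \<Delta> (\<mu> a b) = tensor_map sA sA (\<mu> (\<omega>A a)) \<beta>A (\<Delta> b) +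
      tensor_map sA sA \<alpha>A (\<lambda>a2. \<mu> a2 (\<psi>A b)) (\<Delta> a) +
      fscale l (tensor sA sA (\<alpha>A (\<omega>A a)) (\<beta>A (\<psi>A b))) \<and>
   \<rho> (L a n) + \<rho> (R m b) + \<rho> (\<mu>M m n) =
      tensor_map sA sM (\<mu> (\<omega>A a)) \<beta>M (\<rho> n) +
      tensor_map sA sM \<alpha>A (\<lambda>a2. L a2 (\<psi>M n)) (\<Delta> a) +
      tensor_map sA sM \<alpha>A (\<lambda>m0. R m0 (\<psi>A b)) (\<rho> m) +
      tensor_map sA sM \<alpha>A (\<lambda>m0. \<mu>M m0 (\<psi>M n)) (\<rho> m) +
      fscale l (tensor sA sM (\<alpha>A (\<omega>A a)) (\<beta>M (\<psi>M n))) \<and>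
   \<phi> (L a n) + \<phi> (R m b) + \<phi> (\<mu>M m n) =
      tensor_map sM sA (R (\<omega>M m)) \<beta>A (\<Delta> b) +
      tensor_map sM sA (L (\<omega>A a)) \<beta>A (\<phi> n) +
      tensor_map sM sA (\<mu>M (\<omega>M m)) \<beta>A (\<phi> n) +
      tensor_map sM sA \<alpha>M (\<lambda>b1. \<mu> b1 (\<psi>A b)) (\<phi> m) +
      fscale l (tensor sM sA (\<alpha>M (\<omega>M m)) (\<beta>A (\<psi>A b))) \<and>
   \<Delta>M (L a n) + \<Delta>M (R m b) + \<Delta>M (\<mu>M m n) =
      tensor_map sM sM (R (\<omega>M m)) \<beta>M (\<rho> n) +
      tensor_map sM sM (L (\<omega>A a)) \<beta>M (\<Delta>M n) +
      tensor_map sM sM (\<mu>M (\<omega>M m)) \<beta>M (\<Delta>M n) +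
      tensor_map sM sM \<alpha>M (\<lambda>a1. L a1 (\<psi>M n)) (\<phi> m) +
      tensor_map sM sM \<alpha>M (\<lambda>m2. R m2 (\<psi>A b)) (\<Delta>M m) +
      tensor_map sM sM \<alpha>M (\<lambda>m2. \<mu>M m2 (\<psi>M n)) (\<Delta>M m) +
      fscale l (tensor sM sM (\<alpha>M (\<omega>M m)) (\<beta>M (\<psi>M n)))"
  \<comment> \<open>The first simplification settles membership of both sides in the tensor space,
    using that left and right multiplications are linear; the second computes the four
    blocks.\<close>
  by (subst tensor_eq_iff_blocks)
    (simp_all only: sum_comult_in_space tensor_space_add tensor_space_fscale tensor_in_tensor_space
      tensor_map_in_tensor_space[OF sum_comult_in_space linP(3,2)]
      tensor_map_in_tensor_space[OF sum_comult_in_space linP(1,4)],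
     simp add: sum_mult_Pair sum_comult_blocks tensor_map_sum_comult[OF linP(3,2)]
      tensor_map_sum_comult[OF linP(1,4)] tensor_map_plus tensor_map_scale tensor_map_compose
      linear_fst linear_snd tensor_map_tensor[OF linear_fst linear_fst]
      tensor_map_tensor[OF linear_fst linear_snd] tensor_map_tensor[OF linear_snd linear_fst]
      tensor_map_tensor[OF linear_snd linear_snd] mult_zero structure_zero zero_maps
      in_spaces[THEN tensor_map_add_left] in_spaces[THEN tensor_map_add_right]
      mult_linear linA linM comult_add add_ac)

text \<open>The \<open>A \<otimes> A\<close> block involves only the pair \<open>(a, b)\<close>.
  Each of the other three blocks splits over \<open>(a, n)\<close>, \<open>(m, b)\<close> and
  \<open>(m, n)\<close>, which accounts for the ten conditions.\<close>

lemma compatible_iff: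
  "(\<forall>x y. \<Delta>P (\<mu>P x y) =
      tensor_map sP sP (\<lambda>y1. \<mu>P (\<omega>P x) y1) \<beta>P (\<Delta>P y) +
      tensor_map sP sP \<alpha>P (\<lambda>x2. \<mu>P x2 (\<psi>P y)) (\<Delta>P x) +
      fscale l (tensor sP sP (\<alpha>P (\<omega>P x)) (\<beta>P (\<psi>P y)))) \<longleftrightarrow>
   (\<forall>a b. \<Delta> (\<mu> a b) =
      tensor_map sA sA (\<lambda>b1. \<mu> (\<omega>A a) b1) \<beta>A (\<Delta> b) +
      tensor_map sA sA \<alpha>A (\<lambda>a2. \<mu> a2 (\<psi>A b)) (\<Delta> a) +
      fscale l (tensor sA sA (\<alpha>A (\<omega>A a)) (\<beta>A (\<psi>A b)))) \<and>
   (\<forall>a m. \<rho> (L a m) =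
      tensor_map sA sM (\<lambda>b. \<mu> (\<omega>A a) b) \<beta>M (\<rho> m) +
      tensor_map sA sM \<alpha>A (\<lambda>a2. L a2 (\<psi>M m)) (\<Delta> a) +
      fscale l (tensor sA sM (\<alpha>A (\<omega>A a)) (\<beta>M (\<psi>M m)))) \<and>
   (\<forall>m a. \<phi> (R m a) =
      tensor_map sM sA (\<lambda>a1. R (\<omega>M m) a1) \<beta>A (\<Delta> a) +
      tensor_map sM sA \<alpha>M (\<lambda>b. \<mu> b (\<psi>A a)) (\<phi> m) +
      fscale l (tensor sM sA (\<alpha>M (\<omega>M m)) (\<beta>A (\<psi>A a)))) \<and>
   (\<forall>a m. \<phi> (L a m) = tensor_map sM sA (\<lambda>m0. L (\<omega>A a) m0) \<beta>A (\<phi> m)) \<and>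
   (\<forall>m a. \<rho> (R m a) = tensor_map sA sM \<alpha>A (\<lambda>m0. R m0 (\<psi>A a)) (\<rho> m)) \<and>
   (\<forall>a m. \<Delta>M (L a m) = tensor_map sM sM (\<lambda>m1. L (\<omega>A a) m1) \<beta>M (\<Delta>M m)) \<and>
   (\<forall>m a. \<Delta>M (R m a) = tensor_map sM sM \<alpha>M (\<lambda>m2. R m2 (\<psi>A a)) (\<Delta>M m)) \<and>
   (\<forall>m n. \<rho> (\<mu>M m n) = tensor_map sA sM \<alpha>A (\<lambda>m0. \<mu>M m0 (\<psi>M n)) (\<rho> m)) \<and>
   (\<forall>m n. \<phi> (\<mu>M m n) = tensor_map sM sA (\<lambda>n0. \<mu>M (\<omega>M m) n0) \<beta>A (\<phi> n)) \<and>
   (\<forall>m n. \<Delta>M (\<mu>M m n) =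
      tensor_map sM sM (\<lambda>n1. \<mu>M (\<omega>M m) n1) \<beta>M (\<Delta>M n) +
      tensor_map sM sM \<alpha>M (\<lambda>m2. \<mu>M m2 (\<psi>M n)) (\<Delta>M m) +
      fscale l (tensor sM sM (\<alpha>M (\<omega>M m)) (\<beta>M (\<psi>M n))) +
      tensor_map sM sM (\<lambda>a. R (\<omega>M m) a) \<beta>M (\<rho> n) +
      tensor_map sM sM \<alpha>M (\<lambda>a. L a (\<psi>M n)) (\<phi> m))"
  (is "?P \<longleftrightarrow> ?Q")
proof
  assume ?P
  \<comment> \<open>The free positions of \<open>P'\<close> are, in order of occurrence,
    \<open>a\<close>, \<open>b\<close>, \<open>n\<close>, \<open>m\<close>.\<close>
  note P' = this[unfolded split_paired_All compatible_iff_blocks, rule_format]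
  \<comment> \<open>Multiplication by zero also occurs unapplied, as an argument of
    \<open>tensor_map\<close>, so it is needed as an equation between functions.\<close>
  have "\<mu> 0 = (\<lambda>_. 0)" "\<mu>M 0 = (\<lambda>_. 0)" "L 0 = (\<lambda>_. 0)" "R 0 = (\<lambda>_. 0)"
    by (simp_all add: fun_eq_iff mult_zero)
  note zeros = this mult_zero structure_zero comult_zero tensor_map_0 tensor_zero zero_maps
    module.scale_zero_right[OF module_fscale]
  show ?Q
  proof (intro conjI allI, goal_cases)
    case (1 a b) show ?case using P'[of a b 0 0] by simp
  next
    case (2 a m) show ?case using P'[of a 0 m 0] by (simp add: zeros)
  next
    case (3 m a) show ?case using P'[of 0 a 0 m] by (simp add: zeros)
  next
    case (4 a m) show ?case using P'[of a 0 m 0] by (simp add: zeros)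
  next
    case (5 m a) show ?case using P'[of 0 a 0 m] by (simp add: zeros)
  next
    case (6 a m) show ?case using P'[of a 0 m 0] by (simp add: zeros)
  next
    case (7 m a) show ?case using P'[of 0 a 0 m] by (simp add: zeros)
  next
    case (8 m n) show ?case using P'[of 0 0 n m] by (simp add: zeros)
  next
    case (9 m n) show ?case using P'[of 0 0 n m] by (simp add: zeros)
  next
    case (10 m n) show ?case using P'[of 0 0 n m] by (simp add: zeros add_ac)
  qed
next
  assume ?Q
  then show ?P
    unfolding split_paired_All compatible_iff_blocks
    \<comment> \<open>Each term on the left is replaced by its own condition; the sums then agree up
      to order.\<close>
    by (elim conjE, intro allI conjI) (simp_all (no_asm_simp) only: add_ac)
qed

end

section \<open>Commuting maps and the equivalence itself\<close>

lemma map_prod_commute_iff: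
  "map_prod f g \<circ> map_prod f' g' = map_prod f' g' \<circ> map_prod f g \<longleftrightarrow>
    f \<circ> f' = f' \<circ> f \<and> g \<circ> g' = g' \<circ> g"
proof -
  have "map_prod u v = map_prod u' v' \<longleftrightarrow> u = u' \<and> v = v'" for u u' :: "'a \<Rightarrow> 'a" and v v' :: "'b \<Rightarrow> 'b"
    by (auto simp: fun_eq_iff)
  then show ?thesis
    unfolding map_prod_compose[symmetric] .
qed

text \<open>This separates the commutations inside each of the two pairs, which the module and
  comodule axioms provide, from the mixed ones, which match a clause of the bialgebra axioms on the
  sum.\<close>

lemma pairwise_commuting_4:
  "pairwise_commuting {f, g, h, k} \<longleftrightarrow>
    f \<circ> g = g \<circ> f \<and> h \<circ> k = k \<circ> h \<and> (\<forall>u\<in>{f, g}. \<forall>v\<in>{h, k}. u \<circ> v = v \<circ> u)"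
  unfolding pairwise_commuting_def ball_simps by argo

theorem theorem2p17:
  fixes sA :: "'k::field \<Rightarrow> 'a::ab_group_add \<Rightarrow> 'a"
    and sM :: "'k \<Rightarrow> 'm::ab_group_add \<Rightarrow> 'm"
    and l :: 'k
    and \<mu> :: "'a \<Rightarrow> 'a \<Rightarrow> 'a" and \<Delta> :: "'a \<Rightarrow> ('a, 'a, 'k) tensor"
    and \<alpha>A \<beta>A \<psi>A \<omega>A :: "'a \<Rightarrow> 'a"
    and \<mu>M :: "'m \<Rightarrow> 'm \<Rightarrow> 'm" and \<Delta>M :: "'m \<Rightarrow> ('m, 'm, 'k) tensor"
    and L :: "'a \<Rightarrow> 'm \<Rightarrow> 'm" and R :: "'m \<Rightarrow> 'a \<Rightarrow> 'm"
    and \<rho> :: "'m \<Rightarrow> ('a, 'm, 'k) tensor" and \<phi> :: "'m \<Rightarrow> ('m, 'a, 'k) tensor"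
    and \<alpha>M \<beta>M \<psi>M \<omega>M :: "'m \<Rightarrow> 'm"
  assumes "vector_space sA" and "vector_space sM"
    and "infBH_bialgebra sA l \<mu> \<Delta> \<alpha>A \<beta>A \<psi>A \<omega>A"
    and "bihom_bimodule_algebra sA \<mu> \<alpha>A \<beta>A sM \<mu>M L R \<alpha>M \<beta>M"
    and "bihom_bicomodule_coalgebra sA \<Delta> \<psi>A \<omega>A sM \<Delta>M \<rho> \<phi> \<psi>M \<omega>M"
  shows "infBH_bialgebra (module_prod.scale sA sM) l
           (sum_mult \<mu> \<mu>M L R) (sum_comult sA sM \<Delta> \<Delta>M \<rho> \<phi>)
           (map_prod \<alpha>A \<alpha>M) (map_prod \<beta>A \<beta>M) (map_prod \<psi>A \<psi>M) (map_prod \<omega>A \<omega>M)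
     \<longleftrightarrow>
       infBH_Hopf_bimodule sA l \<mu> \<Delta> \<alpha>A \<beta>A \<psi>A \<omega>A sM L R \<rho> \<phi> \<alpha>M \<beta>M \<psi>M \<omega>M \<and>
       bihom_bimodule_coalgebra sA \<mu> \<alpha>A \<beta>A \<psi>A \<omega>A sM \<Delta>M L R \<alpha>M \<beta>M \<psi>M \<omega>M \<and>
       bihom_bicomodule_algebra sA \<Delta> \<alpha>A \<beta>A \<psi>A \<omega>A sM \<mu>M \<rho> \<phi> \<alpha>M \<beta>M \<psi>M \<omega>M \<and>
       (\<forall>m n. \<Delta>M (\<mu>M m n) =
          tensor_map sM sM (\<lambda>n1. \<mu>M (\<omega>M m) n1) \<beta>M (\<Delta>M n) +
          tensor_map sM sM \<alpha>M (\<lambda>m2. \<mu>M m2 (\<psi>M n)) (\<Delta>M m) +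
          fscale l (tensor sM sM (\<alpha>M (\<omega>M m)) (\<beta>M (\<psi>M n))) +
          tensor_map sM sM (\<lambda>a. R (\<omega>M m) a) \<beta>M (\<rho> n) +
          tensor_map sM sM \<alpha>M (\<lambda>a. L a (\<psi>M n)) (\<phi> m))"
proof -
  note alg = assms(4)[unfolded bihom_bimodule_algebra_def bihom_bimodule_def left_bihom_module_def
      right_bihom_module_def bihom_associative_def]
    and coalg = assms(5)[unfolded bihom_bicomodule_coalgebra_def bihom_bicomodule_def
      left_bihom_comodule_def right_bihom_comodule_def bihom_coassociative_def]
  have "bilinear_map sA sA sA \<mu>" "bilinear_map sM sM sM \<mu>M"
    "bilinear_map sA sM sM L" "bilinear_map sM sA sM R"
    "Vector_Spaces.linear sA sA \<alpha>A" "Vector_Spaces.linear sA sA \<beta>A"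
    "Vector_Spaces.linear sM sM \<alpha>M" "Vector_Spaces.linear sM sM \<beta>M"
    using alg by blast+
  moreover have "linear_to_tensor sA sA sA \<Delta>" "linear_to_tensor sM sM sM \<Delta>M"
    "linear_to_tensor sM sA sM \<rho>" "linear_to_tensor sM sM sA \<phi>"
    "Vector_Spaces.linear sA sA \<psi>A" "Vector_Spaces.linear sA sA \<omega>A"
    "Vector_Spaces.linear sM sM \<psi>M" "Vector_Spaces.linear sM sM \<omega>M"
    using coalg by blast+
  \<comment> \<open>All linearity requirements come from the hypotheses shared by both
    directions.\<close>
  ultimately interpret sum_bialgebra sA sM \<Delta> \<Delta>M \<rho> \<phi> \<mu> \<mu>M L R l \<alpha>A \<beta>A \<psi>A \<omega>A \<alpha>M \<beta>M \<psi>M \<omega>M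
    using assms(1,2)
    by (simp add: sum_bialgebra_def sum_coalgebra_def sum_algebra_def vector_space_sum_def
        sum_coalgebra_axioms_def sum_algebra_axioms_def sum_bialgebra_axioms_def)
  \<comment> \<open>From here the clauses already secured by the hypotheses are collected, so that
    the equivalence concerns the remaining ones only.\<close>
  have "bihom_bimodule sA \<mu> \<alpha>A \<beta>A sM L R \<alpha>M \<beta>M" "bihom_associative sM \<mu>M \<alpha>M \<beta>M"
    using assms(4) by (simp_all add: bihom_bimodule_algebra_def)
  moreover have "bihom_bicomodule sA \<Delta> \<psi>A \<omega>A sM \<rho> \<phi> \<psi>M \<omega>M" "bihom_coassociative sM \<Delta>M \<psi>M \<omega>M"
    using assms(5) by (simp_all add: bihom_bicomodule_coalgebra_def)
  moreover have "bihom_associative sA \<mu> \<alpha>A \<beta>A" "bihom_coassociative sA \<Delta> \<psi>A \<omega>A"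
    "comultiplicative sA \<Delta> \<alpha>A" "comultiplicative sA \<Delta> \<beta>A"
    "multiplicative \<mu> \<psi>A" "multiplicative \<mu> \<omega>A"
    "\<forall>f\<in>{\<alpha>A, \<beta>A}. \<forall>g\<in>{\<psi>A, \<omega>A}. f \<circ> g = g \<circ> f"
    using assms(3) unfolding infBH_bialgebra_def by blast+
  moreover have "\<alpha>M \<circ> \<beta>M = \<beta>M \<circ> \<alpha>M" "\<psi>M \<circ> \<omega>M = \<omega>M \<circ> \<psi>M"
    using alg coalg by blast+
  moreover have "(\<forall>f\<in>{\<alpha>P, \<beta>P}. \<forall>g\<in>{\<psi>P, \<omega>P}. f \<circ> g = g \<circ> f) \<longleftrightarrow>
    (\<forall>f\<in>{\<alpha>A, \<beta>A}. \<forall>g\<in>{\<psi>A, \<omega>A}. f \<circ> g = g \<circ> f) \<and>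
    (\<forall>f\<in>{\<alpha>M, \<beta>M}. \<forall>g\<in>{\<psi>M, \<omega>M}. f \<circ> g = g \<circ> f)"
    unfolding ball_simps map_prod_commute_iff by argo
  ultimately show ?thesis
    using assms(3) sum_associative[OF assms(4)] sum_coassociative[OF assms(5)]
    \<comment> \<open>The bialgebra axioms of the sum are unfolded first and translated by the
      equivalences above, then those of \<open>A\<close>. What remains is propositional.\<close>
    unfolding infBH_bialgebra_def[of sP] infBH_Hopf_bimodule_def bihom_bimodule_coalgebra_def
      bihom_bicomodule_algebra_def pairwise_commuting_4 compatible_iff
      comultiplicative_sum_iff[OF linA(1) linM(1)] comultiplicative_sum_iff[OF linA(2) linM(2)]
      multiplicative_sum_iff[OF linA(3) linM(3)] multiplicative_sum_iff[OF linA(4) linM(4)]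
    unfolding infBH_bialgebra_def
    by argo
qed

end
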